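(* Let $G=(V,E)$ be a trivalent, $2$-edge-connected graph, and let $C$ be a graph curve with dual graph $G$. Then the graph curve matroid $M_G$ coincides with the matroid $M_G'$ on $V$ arising from a generic hyperplane section of the canonical image of $C$.
   Context: Graphs are finite and undirected and may have parallel edges and loops; trivalent means every vertex has degree $3$. For a graph $G=(V,E)$, let $r^*$ be the rank function of the bond (cographic) matroid $M^*(G)$, the dual of the cycle matroid of $G$. Thus $r^*(B)=|B|-r(E)+r(E- B)$, where $r(F)=|V|-(\text{number of connected components of }(V,F))$. For $A\subseteq V$ let $\delta(A)$ be the set of edges incident to at least one vertex of $A$. The graph curve matroid $M_G$ is the matroid on ground set $V$ whose circuits are the non-empty subsets $A\subseteq V$ that are inclusion-minimal among non-empty subsets satisfying $r^*(\delta(A))\le |A|$. A graph curve is a connected projective algebraic curve whose irreducible components are copies of $\mathbb{P}^1$, meeting only in nodes, such that each component has exactly three distinct intersection points with other components. Its dual graph has one vertex per component and one edge per intersection point of two components. Every trivalent loopless graph is the dual graph of some graph curve. Let $g$ be the arithmetic genus of $C$, which equals the first Betti number $|E|-|V|+1$ of $G$. When $G$ is $2$-edge-connected, the dualizing sheaf $\omega_C$ is base point free. The canonical map $C\to\mathbb{P}(H^0(\omega_C))\cong\mathbb{P}^{g-1}$ pulls back $\mathcal{O}(1)$ to $\omega_C$, and it sends the component corresponding to vertex $i$ isomorphically onto a line $L_i\subseteq\mathbb{P}^{g-1}$. Distinct components may have the same image line. For a generic hyperplane $H\subseteq\mathbb{P}^{g-1}$, set $p_i=L_i\cap H$ for $i\in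 V$. This gives a multiset of $|V|$ points, possibly with repetitions. $M_G'$ is the matroid on $V$ in which $A\subseteq V$ is independent if and only if chosen representing vectors of the points $p_i$, $i\in A$ (counted with repetition), are linearly independent. By genericity of $H$, this matroid depends only on $G$. *)

theory Defs
  imports
    "HOL-Library.Multiset"
    "HOL-Computational_Algebra.Computational_Algebra"
    "Jordan_Normal_Form.Matrix"
begin

section \<open>Multigraphs\<close>

text \<open>Parallel edges are distinct elements of the edge set with the same ends; a loop at \<open>v\<close>
  has \<open>ends = {#v, v#}\<close>.\<close>

record ('v, 'e) multigraph =
  verts :: "'v set"
  edges :: "'e set"
  ends :: "'e \<Rightarrow> 'v multiset"

definition finite_multigraph :: "('v, 'e) multigraph \<Rightarrow> bool" where
  "finite_multigraph G \<longleftrightarrow> finite (verts G) \<and> finite (edges G) \<and>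
     (\<forall>e\<in>edges G. size (ends G e) = 2 \<and> set_mset (ends G e) \<subseteq> verts G)"

definition degree :: "('v, 'e) multigraph \<Rightarrow> 'v \<Rightarrow> nat" where
  "degree G v = (\<Sum>e\<in>edges G. count (ends G e) v)"

definition trivalent :: "('v, 'e) multigraph \<Rightarrow> bool" where
  "trivalent G \<longleftrightarrow> (\<forall>v\<in>verts G. degree G v = 3)"

definition reachable_in :: "('v, 'e) multigraph \<Rightarrow> 'e set \<Rightarrow> ('v \<times> 'v) set" where
  "reachable_in G F = {(u, w). \<exists>e\<in>F. ends G e = {#u, w#}}\<^sup>* \<inter> verts G \<times> verts G"

definition num_components :: "('v, 'e) multigraph \<Rightarrow> 'e set \<Rightarrow> nat" where
  "num_components G F = card (verts G // reachable_in G F)"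

definition connected_graph :: "('v, 'e) multigraph \<Rightarrow> bool" where
  "connected_graph G \<longleftrightarrow> num_components G (edges G) = 1"

definition two_edge_connected :: "('v, 'e) multigraph \<Rightarrow> bool" where
  "two_edge_connected G \<longleftrightarrow>
     (\<forall>F\<subseteq>edges G. card F < 2 \<longrightarrow> num_components G (edges G - F) = 1)"

section \<open>The graph curve matroid\<close>

text \<open>\<open>cycle_rank\<close> is the rank function \<open>r\<close> of the cycle matroid and \<open>bond_rank\<close> the rank
  function \<open>r*\<close> of its dual; they are integer valued, so the subtractions do not truncate.\<close>

definition cycle_rank :: "('v, 'e) multigraph \<Rightarrow> 'e set \<Rightarrow> int" where
  "cycle_rank G F = int (card (verts G)) - int (num_components G F)"

definition bond_rank :: "('v, 'e) multigraph \<Rightarrow> 'e set \<Rightarrow> int" where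
  "bond_rank G B = int (card B) - cycle_rank G (edges G) + cycle_rank G (edges G - B)"

definition incident_edges :: "('v, 'e) multigraph \<Rightarrow> 'v set \<Rightarrow> 'e set" where
  "incident_edges G A = {e \<in> edges G. set_mset (ends G e) \<inter> A \<noteq> {}}"

definition gc_dependent :: "('v, 'e) multigraph \<Rightarrow> 'v set \<Rightarrow> bool" where
  "gc_dependent G A \<longleftrightarrow> A \<subseteq> verts G \<and> A \<noteq> {} \<and> bond_rank G (incident_edges G A) \<le> int (card A)"

definition gc_circuits :: "('v, 'e) multigraph \<Rightarrow> 'v set set" where
  "gc_circuits G = {A. gc_dependent G A \<and> (\<forall>B. gc_dependent G B \<and> B \<subseteq> A \<longrightarrow> B = A)}"

text \<open>A matroid is given by its ground set and its family of independent sets.\<close>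

type_synonym 'v matroid = "'v set \<times> 'v set set"

definition matroid_of_circuits :: "'v set \<Rightarrow> 'v set set \<Rightarrow> 'v matroid" where
  "matroid_of_circuits V \<C> = (V, {A. A \<subseteq> V \<and> \<not> (\<exists>C\<in>\<C>. C \<subseteq> A)})"

definition graph_curve_matroid :: "('v, 'e) multigraph \<Rightarrow> 'v matroid" where
  "graph_curve_matroid G = matroid_of_circuits (verts G) (gc_circuits G)"

section \<open>Projective space\<close>

text \<open>A point of \<open>\<P>\<^bsup>n-1\<^esup>\<close> is the set of all its homogeneous coordinate vectors.\<close>

definition proj_point :: "'k::field vec \<Rightarrow> 'k vec set" where
  "proj_point x = {c \<cdot>\<^sub>v x | c. c \<noteq> 0}"

definition proj_space :: "nat \<Rightarrow> 'k::field vec set set" where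
  "proj_space n = proj_point ` (carrier_vec n - {0\<^sub>v n})"

text \<open>A hyperplane of \<open>\<P>\<^bsup>n-1\<^esup>\<close> is given by a point \<open>\<xi>\<close> of the dual projective space, the class
  of its coefficient vector.\<close>

definition hyperplane :: "nat \<Rightarrow> 'k::field vec set \<Rightarrow> 'k vec set set" where
  "hyperplane n \<xi> = {p \<in> proj_space n. \<forall>h\<in>\<xi>. \<forall>x\<in>p. h \<bullet> x = 0}"

inductive_set poly_funs :: "nat \<Rightarrow> ('k::field vec \<Rightarrow> 'k) set" for n where
  const: "(\<lambda>x. c) \<in> poly_funs n"
| coord: "i < n \<Longrightarrow> (\<lambda>x. vec_index x i) \<in> poly_funs n"
| add: "f \<in> poly_funs n \<Longrightarrow> g \<in> poly_funs n \<Longrightarrow> (\<lambda>x. f x + g x) \<in> poly_funs n"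
| mult: "f \<in> poly_funs n \<Longrightarrow> g \<in> poly_funs n \<Longrightarrow> (\<lambda>x. f x * g x) \<in> poly_funs n"

text \<open>Over an infinite field (all that is used below), a polynomial function is homogeneous in the
  following sense iff the polynomial is.\<close>

definition homogeneous_poly_funs :: "nat \<Rightarrow> ('k::field vec \<Rightarrow> 'k) set" where
  "homogeneous_poly_funs n =
     {f \<in> poly_funs n. \<exists>d. \<forall>c. \<forall>x\<in>carrier_vec n. f (c \<cdot>\<^sub>v x) = c ^ d * f x}"

definition zariski_open :: "nat \<Rightarrow> 'k::field vec set set \<Rightarrow> bool" where
  "zariski_open n U \<longleftrightarrow>
     (\<exists>S\<subseteq>homogeneous_poly_funs n. U = {p \<in> proj_space n. \<exists>f\<in>S. \<exists>x\<in>p. f x \<noteq> 0})"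

definition generic_hyperplane :: "nat \<Rightarrow> ('k::field vec set set \<Rightarrow> bool) \<Rightarrow> bool" where
  "generic_hyperplane n P \<longleftrightarrow> (\<exists>U. zariski_open n U \<and> U \<noteq> {} \<and> (\<forall>\<xi>\<in>U. P (hyperplane n \<xi>)))"

section \<open>Rational differentials on the projective line\<close>

datatype 'k proj_line = Aff 'k | Infty

text \<open>The coordinate \<open>z\<close> of \<open>\<P>\<^sup>1\<close> as a Laurent series in the local parameter \<open>t\<close> at a point:
  \<open>t = z - a\<close> at \<open>a\<close> and \<open>t = 1/z\<close> at infinity.\<close>

primrec local_coord :: "'k::field proj_line \<Rightarrow> 'k fls" where
  "local_coord (Aff a) = fls_const a + fls_X"
| "local_coord Infty = fls_X_inv"

text \<open>Substituting a Laurent series \<open>z\<close> into a rational function.  The value is unique whenever no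
  nonzero polynomial vanishes at \<open>z\<close>, in particular for \<open>z = local_coord x\<close>.\<close>

definition subst_fls :: "'k::field fls \<Rightarrow> 'k poly fract \<Rightarrow> 'k fls" where
  "subst_fls z f = (THE y. \<exists>p q. q \<noteq> 0 \<and> f = Fract p q \<and>
     y = poly (map_poly fls_const p) z / poly (map_poly fls_const q) z)"

text \<open>A rational function \<open>f\<close> stands for the differential \<open>f dz\<close>; its expansion at \<open>x\<close> is the
  Laurent series \<open>f(z(t)) z'(t)\<close>, the coefficient of \<open>dt\<close>.\<close>

definition diff_expansion :: "'k::field proj_line \<Rightarrow> 'k poly fract \<Rightarrow> 'k fls" where
  "diff_expansion x f = subst_fls (local_coord x) f * fls_deriv (local_coord x)"

definition diff_residue :: "'k::field proj_line \<Rightarrow> 'k poly fract \<Rightarrow> 'k" where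
  "diff_residue x f = fls_nth (diff_expansion x f) (-1)"

section \<open>Graph curves\<close>

text \<open>A nodal curve whose components are copies of \<open>\<P>\<^sup>1\<close> is presented by its normalization, the
  disjoint union of the lines \<open>{v} \<times> \<P>\<^sup>1\<close> for \<open>v \<in> comps\<close>, together with, for each node, the pair
  \<open>branches\<close> of points of the normalization that are glued.  Such a curve is determined by, and
  exists for, every such choice of pairwise disjoint pairs.\<close>

record ('v, 'e, 'k) glued_curve =
  comps :: "'v set"
  nodes :: "'e set"
  branches :: "'e \<Rightarrow> ('v \<times> 'k proj_line) set"

definition dual_graph :: "('v, 'e, 'k) glued_curve \<Rightarrow> ('v, 'e) multigraph" where
  "dual_graph C = \<lparr>verts = comps C, edges = nodes C,
     ends = (\<lambda>e. image_mset fst (mset_set (branches C e)))\<rparr>"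

text \<open>Equality with the dual graph, ignoring the values of \<open>ends\<close> outside the edge set.\<close>

definition has_dual_graph :: "('v, 'e, 'k) glued_curve \<Rightarrow> ('v, 'e) multigraph \<Rightarrow> bool" where
  "has_dual_graph C G \<longleftrightarrow> verts G = verts (dual_graph C) \<and> edges G = edges (dual_graph C) \<and>
     (\<forall>e\<in>edges G. ends G e = ends (dual_graph C) e)"

definition node_points :: "('v, 'e, 'k) glued_curve \<Rightarrow> 'v \<Rightarrow> 'k proj_line set" where
  "node_points C v = {x. \<exists>e\<in>nodes C. (v, x) \<in> branches C e}"

text \<open>The curve is connected iff its dual graph is.  The condition on \<open>fst ` branches C e\<close> says
  that each node lies on two different components.\<close>

definition graph_curve :: "('v, 'e, 'k) glued_curve \<Rightarrow> bool" where
  "graph_curve C \<longleftrightarrow> finite (comps C) \<and> finite (nodes C) \<and>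
     (\<forall>e\<in>nodes C. card (branches C e) = 2 \<and> card (fst ` branches C e) = 2 \<and>
        fst ` branches C e \<subseteq> comps C) \<and>
     (\<forall>e\<in>nodes C. \<forall>e'\<in>nodes C. e \<noteq> e' \<longrightarrow> branches C e \<inter> branches C e' = {}) \<and>
     (\<forall>v\<in>comps C. card (node_points C v) = 3) \<and>
     connected_graph (dual_graph C)"

text \<open>Global sections of the dualizing sheaf of a nodal curve: rational differentials on the
  normalization, regular away from the points over the nodes, with at most simple poles there, and
  with residues adding up to zero on the two branches of each node.  Differentials are extended by
  \<open>0\<close> outside \<open>comps C\<close>.\<close>

definition dualizing_sections ::
    "('v, 'e, 'k::field) glued_curve \<Rightarrow> ('v \<Rightarrow> 'k poly fract) set" where
  "dualizing_sections C = {\<eta>.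
     (\<forall>v. v \<notin> comps C \<longrightarrow> \<eta> v = 0) \<and>
     (\<forall>v\<in>comps C. \<forall>x. fls_subdegree (diff_expansion x (\<eta> v)) \<ge>
        (if x \<in> node_points C v then -1 else 0)) \<and>
     (\<forall>e\<in>nodes C. (\<Sum>(v, x)\<in>branches C e. diff_residue x (\<eta> v)) = 0)}"

text \<open>\<open>s\<^sub>0, \<dots>, s\<^bsub>g-1\<^esub>\<close> is a basis of the space of global sections; its length \<open>g\<close> is the
  arithmetic genus.\<close>

definition canonical_basis ::
    "('v, 'e, 'k::field) glued_curve \<Rightarrow> nat \<Rightarrow> (nat \<Rightarrow> 'v \<Rightarrow> 'k poly fract) \<Rightarrow> bool" where
  "canonical_basis C g s \<longleftrightarrow> (\<forall>j<g. s j \<in> dualizing_sections C) \<and>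
     (\<forall>\<eta>\<in>dualizing_sections C. \<exists>!c. c \<in> carrier_vec g \<and>
        (\<forall>v. \<eta> v = (\<Sum>j<g. Fract [:vec_index c j:] 1 * s j v)))"

text \<open>The value of a section at the point \<open>x\<close> of component \<open>v\<close>, in the trivialization of the
  dualizing sheaf restricted to \<open>v\<close> by \<open>dt/t\<close> if \<open>x\<close> is a node and by \<open>dt\<close> otherwise.\<close>

definition section_value ::
    "('v, 'e, 'k::field) glued_curve \<Rightarrow> 'v \<Rightarrow> 'k proj_line \<Rightarrow> ('v \<Rightarrow> 'k poly fract) \<Rightarrow> 'k" where
  "section_value C v x \<eta> =
     fls_nth (diff_expansion x (\<eta> v)) (if x \<in> node_points C v then -1 else 0)"

definition canonical_map ::
    "('v, 'e, 'k::field) glued_curve \<Rightarrow> nat \<Rightarrow> (nat \<Rightarrow> 'v \<Rightarrow> 'k poly fract) \<Rightarrow>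
      'v \<Rightarrow> 'k proj_line \<Rightarrow> 'k vec set" where
  "canonical_map C g s v x = proj_point (vec g (\<lambda>j. section_value C v x (s j)))"

definition canonical_line ::
    "('v, 'e, 'k::field) glued_curve \<Rightarrow> nat \<Rightarrow> (nat \<Rightarrow> 'v \<Rightarrow> 'k poly fract) \<Rightarrow>
      'v \<Rightarrow> 'k vec set set" where
  "canonical_line C g s v = range (canonical_map C g s v)"

section \<open>The matroid of a family of points\<close>

text \<open>Independence of a family rather than a set of points: repeated points are dependent.\<close>

definition points_independent :: "nat \<Rightarrow> ('v \<Rightarrow> 'k::field vec set) \<Rightarrow> 'v set \<Rightarrow> bool" where
  "points_independent n p A \<longleftrightarrow> (\<exists>w. (\<forall>i\<in>A. w i \<in> p i) \<and>
     (\<forall>c. (\<forall>j<n. (\<Sum>i\<in>A. c i * vec_index (w i) j) = 0) \<longrightarrow> (\<forall>i\<in>A. c i = 0)))"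

definition point_matroid :: "nat \<Rightarrow> 'v set \<Rightarrow> ('v \<Rightarrow> 'k::field vec set) \<Rightarrow> 'v matroid" where
  "point_matroid n V p = (V, {A. A \<subseteq> V \<and> points_independent n p A})"

end

theory Submission
  imports Defs "Jordan_Normal_Form.Determinant" "HOL-Library.Function_Algebras"
begin

text \<open>A differential on a component is determined by its three residues, which sum to zero, so the
  sections of the dualizing sheaf are the flows on the dual graph and the image line of the component
  \<open>v\<close> is spanned by the residue functionals at the three nodes on \<open>v\<close>.  Cycles and cuts of the graph
  show that the residue functionals represent the bond matroid; hence the lines indexed by \<open>B\<close>
  span a space of vector dimension \<open>r*(\<delta>(B))\<close>.  By a theorem of Lovasz, the points cut out on a family of
  lines by a generic hyperplane are independent iff every nonempty subfamily \<open>B\<close> of the lines spans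
  a space of vector dimension at least \<open>|B| + 1\<close>.\<close>

text \<open>The two directions of the comparison are unequal. If the section points of B are
  independent, they span dimension |B| inside H, while some generator of a line of B lies off H;
  this is the source of the \<open>+ 1\<close>, and it needs only that H contains none of the lines.
  For the converse a hyperplane has to be produced, and the order of choice is reversed: points are
  picked on the lines one after another, independent and with no line in their span, and H is then a
  hyperplane through all of them that contains no line. One such H suffices for a given set, because
  independence follows from the nonvanishing of a determinant that is a form in the coefficients of
  H. As there are finitely many vertex sets and the field is infinite, the product of these forms is
  nonzero somewhere and yields one open set for all of them. Singletons are among these sets, so no
  line lies in such an H. That singletons are independent, which means that a component maps to a
  line and not to a point, is where 2-edge-connectedness enters: two of the three edges at a vertex
  can be removed together without disconnecting the graph.\<close>

section \<open>Laurent expansions of rational functions\<close>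

text \<open>The coefficient \<open>c\<close> may be \<open>0\<close>; then \<open>f\<close> vanishes to order greater than \<open>k\<close>.\<close>

definition has_lead :: "'k::field fls \<Rightarrow> int \<Rightarrow> 'k \<Rightarrow> bool" where
  "has_lead f k c \<longleftrightarrow> (\<forall>n<k. fls_nth f n = 0) \<and> fls_nth f k = c"

lemma has_leadD: "has_lead f k c \<Longrightarrow> fls_nth f k = c"
  by (simp add: has_lead_def)

lemma has_lead_zero [simp]: "has_lead 0 k 0"
  by (simp add: has_lead_def)

lemma has_lead_const: "has_lead (fls_const c) 0 c"
  by (simp add: has_lead_def)

lemma has_lead_add: "has_lead f k c \<Longrightarrow> has_lead g k d \<Longrightarrow> has_lead (f + g) k (c + d)"
  by (simp add: has_lead_def)

lemma has_lead_uminus: "has_lead f k c \<Longrightarrow> has_lead (- f) k (- c)"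
  by (simp add: has_lead_def)

lemma has_lead_weaken: "has_lead f k c \<Longrightarrow> j < k \<Longrightarrow> has_lead f j 0"
  by (simp add: has_lead_def)

lemma has_lead_subdegree: "has_lead f k c \<Longrightarrow> c \<noteq> 0 \<Longrightarrow> fls_subdegree f = k"
  by (auto simp: has_lead_def intro: fls_subdegree_eqI)

lemma has_lead_nonzero: "has_lead f k c \<Longrightarrow> c \<noteq> 0 \<Longrightarrow> f \<noteq> 0"
  by (auto simp: has_lead_def)

lemma has_lead_le_subdegree: "has_lead f k c \<Longrightarrow> f \<noteq> 0 \<Longrightarrow> k \<le> fls_subdegree f"
  by (auto simp: has_lead_def intro: fls_subdegree_geI)

lemma has_lead_iff_subdegree:
  "f \<noteq> 0 \<Longrightarrow> has_lead f k c \<longleftrightarrow> k \<le> fls_subdegree f \<and> fls_nth f k = c"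
  using has_lead_le_subdegree[of f k c] by (auto simp: has_lead_def)

text \<open>\<open>c\<close> or \<open>d\<close> may be zero; then one factor has order above its
  bound, and the coefficient of the product at \<open>i + j\<close> vanishes along with
  \<open>c * d\<close>.\<close>

lemma has_lead_mult:
  assumes f: "has_lead f i c" and g: "has_lead g j d"
  shows "has_lead (f * g) (i + j) (c * d)"
proof (cases "f = 0 \<or> g = 0")
  case True
  then show ?thesis using f g by (auto simp: has_lead_def)
next
  case False
  then have nz: "f \<noteq> 0" "g \<noteq> 0" "f * g \<noteq> 0" by auto
  have le: "i \<le> fls_subdegree f" "j \<le> fls_subdegree g"
    using has_lead_le_subdegree[OF f] has_lead_le_subdegree[OF g] nz by auto
  have "fls_nth (f * g) (i + j) = c * d"
  proof (cases "i = fls_subdegree f \<and> j = fls_subdegree g")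
    case True
    then show ?thesis using f g by (simp add: has_lead_def)
  next
    case False
    then have lt: "i < fls_subdegree f \<or> j < fls_subdegree g" using le by auto
    then have "c * d = 0" using f g by (auto simp: has_lead_def)
    moreover have "fls_nth (f * g) (i + j) = 0"
      using lt le by (intro fls_times_nth_eq0) auto
    ultimately show ?thesis by simp
  qed
  then show ?thesis using le nz by (simp add: has_lead_iff_subdegree)
qed

lemma has_lead_inverse:
  assumes g: "has_lead g j d" and d: "d \<noteq> 0"
  shows "has_lead (inverse g) (- j) (inverse d)"
proof -
  have sd: "fls_subdegree g = j" and nz: "g \<noteq> 0"
    using has_lead_subdegree[OF g d] has_lead_nonzero[OF g d] by auto
  then have "inverse g \<noteq> 0" by simp
  then show ?thesis using sd nz g fls_inverse_base2[of g]
    by (simp add: has_lead_iff_subdegree has_lead_def)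
qed

lemma has_lead_divide:
  "has_lead f i c \<Longrightarrow> has_lead g j d \<Longrightarrow> d \<noteq> 0 \<Longrightarrow> has_lead (f / g) (i - j) (c / d)"
  using has_lead_mult[OF _ has_lead_inverse, of f i c g j d] by (simp add: divide_inverse)

lemma has_lead_power:
  "has_lead f i c \<Longrightarrow> has_lead (f ^ n) (int n * i) (c ^ n)"
proof (induction n)
  case 0
  then show ?case by (simp add: has_lead_def)
next
  case (Suc n)
  then show ?case using has_lead_mult[of f i c "f ^ n" "int n * i" "c ^ n"]
    by (simp add: algebra_simps)
qed

section \<open>Substitution of a Laurent series into polynomials and fractions\<close>

definition fls_eval :: "'k::field fls \<Rightarrow> 'k poly \<Rightarrow> 'k fls" where
  "fls_eval z p = poly (map_poly fls_const p) z"

lemma fls_eval_0 [simp]: "fls_eval z 0 = 0"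
  by (simp add: fls_eval_def)

lemma fls_eval_pCons [simp]: "fls_eval z (pCons c p) = fls_const c + z * fls_eval z p"
  by (simp add: fls_eval_def map_poly_pCons)

lemma fls_eval_add: "fls_eval z (p + q) = fls_eval z p + fls_eval z q"
  by (induction p q rule: poly_induct2) (auto simp: algebra_simps simp flip: fls_plus_const)

lemma fls_eval_smult: "fls_eval z (Polynomial.smult c p) = fls_const c * fls_eval z p"
  by (induction p) (auto simp: algebra_simps)

lemma fls_eval_mult: "fls_eval z (p * q) = fls_eval z p * fls_eval z q"
  by (induction p) (auto simp: algebra_simps fls_eval_add fls_eval_smult)

lemma fls_eval_1 [simp]: "fls_eval z 1 = 1"
  by (simp add: one_pCons)

lemma fls_eval_power: "fls_eval z (p ^ n) = fls_eval z p ^ n"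
  by (induction n) (auto simp: fls_eval_mult)

lemma has_lead_eval_Aff: "has_lead (fls_eval (fls_const a + fls_X) p) 0 (poly p a)"
proof (induction p)
  case 0
  then show ?case by simp
next
  case (pCons c p)
  have "has_lead (fls_const a + fls_X) 0 a" by (simp add: has_lead_def)
  from has_lead_add[OF has_lead_const[of c] has_lead_mult[OF this pCons(2), simplified]]
  show ?case by simp
qed

text \<open>Splitting off the full power of \<open>X - a\<close> leaves a cofactor with nonzero
  value at \<open>a\<close>, so the order of vanishing is exact. This is what detects forbidden
  poles later.\<close>

lemma has_lead_eval_Aff_order:
  assumes "p \<noteq> 0"
  shows "\<exists>c. c \<noteq> 0 \<and> has_lead (fls_eval (fls_const a + fls_X) p) (int (Polynomial.order a p)) c"
proof -
  obtain r where p: "p = [:- a, 1:] ^ Polynomial.order a p * r" and r: "\<not> [:- a, 1:] dvd r"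
    using order_decomp[OF assms] by metis
  have r0: "poly r a \<noteq> 0" using r by (simp add: poly_eq_0_iff_dvd)
  have "has_lead (fls_eval (fls_const a + fls_X) [:- a, 1:]) 1 1"
    by (simp add: has_lead_def)
  from has_lead_mult[OF has_lead_power[OF this] has_lead_eval_Aff[of a r]]
  have "has_lead (fls_eval (fls_const a + fls_X) p) (int (Polynomial.order a p)) (poly r a)"
    by (subst p) (simp add: fls_eval_mult fls_eval_power)
  with r0 show ?thesis by blast
qed

text \<open>\<open>n\<close> may exceed the degree; the coefficient is then 0, as is wanted for a
  numerator \<open>alpha + beta z\<close> whose \<open>beta\<close> may vanish.\<close>

lemma has_lead_eval_Infty:
  "Polynomial.degree p \<le> n \<Longrightarrow> has_lead (fls_eval fls_X_inv p) (- int n) (Polynomial.coeff p n)"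
proof (induction p arbitrary: n)
  case 0
  then show ?case by simp
next
  case (pCons c p)
  show ?case
  proof (cases n)
    case 0
    then have "p = 0" using pCons.prems by (simp split: if_splits)
    then show ?thesis using 0 by (simp add: has_lead_const)
  next
    case (Suc m)
    have "Polynomial.degree p \<le> m" using pCons.prems Suc by (simp split: if_splits)
    then have "has_lead (fls_eval fls_X_inv p) (- int m) (Polynomial.coeff p m)" by (rule pCons.IH)
    moreover have "has_lead fls_X_inv (- 1) (1 :: 'a)" by (simp add: has_lead_def)
    ultimately have "has_lead (fls_X_inv * fls_eval fls_X_inv p) (- int n) (Polynomial.coeff p m)"
      using has_lead_mult[of fls_X_inv "-1" "1::'a"] Suc by fastforce
    from has_lead_add[OF has_lead_weaken[OF has_lead_const[of c]] this] show ?thesis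
      using Suc by simp
  qed
qed

text \<open>The local coordinate is transcendental over the constants. This is what makes the
  definite description in \<open>subst_fls\<close> independent of the representing fraction.\<close>

lemma fls_eval_local_coord_nonzero:
  assumes "p \<noteq> 0"
  shows "fls_eval (local_coord x) p \<noteq> 0"
proof (cases x)
  case (Aff a)
  then show ?thesis using has_lead_eval_Aff_order[OF assms, of a] has_lead_nonzero by auto
next
  case Infty
  then show ?thesis
    using has_lead_eval_Infty[of p "Polynomial.degree p"] has_lead_nonzero assms by fastforce
qed

lemma subst_fls_Fract:
  assumes "q \<noteq> 0"
  shows "subst_fls (local_coord x) (Fract p q)
    = fls_eval (local_coord x) p / fls_eval (local_coord x) q"
  unfolding subst_fls_def
proof (rule the_equality, goal_cases)
  case 1
  then show ?case using assms unfolding fls_eval_def by blast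
next
  case (2 y)
  then obtain p' q' where q': "q' \<noteq> 0" and eq: "Fract p q = Fract p' q'"
    and y: "y = fls_eval (local_coord x) p' / fls_eval (local_coord x) q'"
    unfolding fls_eval_def by blast
  have "p * q' = p' * q" using eq assms q' by (simp add: eq_fract)
  then have "fls_eval (local_coord x) p * fls_eval (local_coord x) q'
    = fls_eval (local_coord x) p' * fls_eval (local_coord x) q"
    by (metis fls_eval_mult)
  then show ?case using y fls_eval_local_coord_nonzero[OF assms, of x]
      fls_eval_local_coord_nonzero[OF q', of x] by (simp add: frac_eq_eq)
qed

lemma diff_expansion_Aff:
  assumes "q \<noteq> 0"
  shows "diff_expansion (Aff a) (Fract p q)
    = fls_eval (fls_const a + fls_X) p / fls_eval (fls_const a + fls_X) q"
  using subst_fls_Fract[OF assms, of "Aff a" p] by (simp add: diff_expansion_def)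

text \<open>With \<open>z = 1/t\<close> one has \<open>dz = - t^(-2) dt\<close>, whence the sign and
  the square.\<close>

lemma diff_expansion_Infty:
  assumes "q \<noteq> 0"
  shows "diff_expansion Infty (Fract p q)
    = - (fls_eval fls_X_inv p / fls_eval fls_X_inv q * fls_X_inv\<^sup>2)"
  using subst_fls_Fract[OF assms, of Infty p] by (simp add: diff_expansion_def)

section \<open>Differentials with three simple poles on the projective line\<close>

text \<open>The differentials with at most simple poles at three points \<open>N\<close> are
  \<open>(alpha + beta z) dz / pole_poly N\<close>. A pole at infinity needs no factor: it shows as
  a denominator of degree 2 in place of 3.\<close>

definition pole_poly :: "'k::field proj_line set \<Rightarrow> 'k poly" where
  "pole_poly N = (\<Prod>a\<in>{a. Aff a \<in> N}. [:- a, 1:])"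

text \<open>A linear form evaluated at the homogeneous coordinates \<open>(1 : a)\<close> or
  \<open>(0 : 1)\<close> of the point.\<close>

definition line_form :: "'k::field \<Rightarrow> 'k \<Rightarrow> 'k proj_line \<Rightarrow> 'k" where
  "line_form \<alpha> \<beta> x = (case x of Aff a \<Rightarrow> \<alpha> + a * \<beta> | Infty \<Rightarrow> \<beta>)"

text \<open>At a finite point this is the reciprocal of the derivative of \<open>pole_poly N\<close>
  if the point is a pole, and of its value otherwise. The \<open>- 1\<close> at infinity comes from
  \<open>dz = - t^(-2) dt\<close>.\<close>

definition value_factor :: "'k::field proj_line set \<Rightarrow> 'k proj_line \<Rightarrow> 'k" where
  "value_factor N x = (case x of
     Aff a \<Rightarrow> inverse (\<Prod>b\<in>{b. Aff b \<in> N} - {a}. a - b) | Infty \<Rightarrow> - 1)"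

lemma finite_Aff: "finite N \<Longrightarrow> finite {a. Aff a \<in> N}"
  using finite_vimageI[of N Aff] by (simp add: vimage_def inj_def)

lemma card_Aff:
  assumes "finite N"
  shows "card {a. Aff a \<in> N} = card (N - {Infty})"
proof -
  have "N - {Infty} = Aff ` {a. Aff a \<in> N}"
    by (auto simp: image_iff) (metis proj_line.exhaust)
  then show ?thesis by (simp add: card_image inj_on_def)
qed

lemma pole_poly_nonzero [simp]: "finite N \<Longrightarrow> pole_poly N \<noteq> 0"
  unfolding pole_poly_def using finite_Aff[of N] by simp

lemma value_factor_nonzero: "finite N \<Longrightarrow> value_factor N x \<noteq> 0"
  using finite_Aff[of N] by (auto simp: value_factor_def split: proj_line.splits)

lemma degree_pole_poly:
  assumes "finite N"
  shows "Polynomial.degree (pole_poly N) = card (N - {Infty})"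
proof -
  have "Polynomial.degree (pole_poly N) = (\<Sum>a\<in>{a. Aff a \<in> N}. 1)"
    unfolding pole_poly_def by (subst degree_prod_eq_sum_degree) auto
  then show ?thesis using card_Aff[OF assms] by simp
qed

lemma lead_coeff_pole_poly: "Polynomial.coeff (pole_poly N) (Polynomial.degree (pole_poly N)) = 1"
  unfolding pole_poly_def by (simp add: lead_coeff_prod)

lemma poly_pole_poly: "poly (pole_poly N) a = (\<Prod>b\<in>{b. Aff b \<in> N}. a - b)"
  unfolding pole_poly_def by (simp add: poly_prod)

lemma has_lead_pole_poly:
  assumes "finite N"
  shows "has_lead (fls_eval (fls_const a + fls_X) (pole_poly N)) (if Aff a \<in> N then 1 else 0)
    (inverse (value_factor N (Aff a)))"
proof (cases "Aff a \<in> N")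
  case True
  define Q where "Q = (\<Prod>b\<in>{b. Aff b \<in> N} - {a}. [:- b, 1:])"
  have "pole_poly N = [:- a, 1:] * Q"
    unfolding pole_poly_def Q_def using True finite_Aff[OF assms]
    by (subst prod.remove[of _ a]) auto
  moreover have "has_lead (fls_eval (fls_const a + fls_X) [:- a, 1:]) 1 1"
    by (simp add: has_lead_def)
  moreover have "poly Q a = inverse (value_factor N (Aff a))"
    by (simp add: Q_def value_factor_def poly_prod)
  ultimately show ?thesis
    using True has_lead_mult[OF _ has_lead_eval_Aff[of a Q], of _ 1 1] by (simp only: fls_eval_mult) simp
next
  case False
  then have "{b. Aff b \<in> N} - {a} = {b. Aff b \<in> N}" by auto
  then show ?thesis using False has_lead_eval_Aff[of a "pole_poly N"]
    by (simp add: value_factor_def poly_pole_poly)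
qed

text \<open>One formula covers residues at nodes and values elsewhere. Up to the nonzero
  \<open>value_factor\<close>, both are \<open>line_form\<close> at \<open>x\<close>, which is why
  the image of a component lies on a line.\<close>

lemma has_lead_diff_expansion:
  assumes N: "card N = 3"
  shows "has_lead (diff_expansion x (Fract [:\<alpha>, \<beta>:] (pole_poly N))) (if x \<in> N then - 1 else 0)
    (value_factor N x * line_form \<alpha> \<beta> x)"
proof -
  have fin: "finite N" using N card.infinite by fastforce
  show ?thesis
  proof (cases x)
    case (Aff a)
    have "has_lead (fls_eval (fls_const a + fls_X) [:\<alpha>, \<beta>:]) 0 (line_form \<alpha> \<beta> (Aff a))"
      using has_lead_eval_Aff[of a "[:\<alpha>, \<beta>:]"] by (simp add: line_form_def)
    from has_lead_divide[OF this has_lead_pole_poly[OF fin]]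
    have "has_lead (diff_expansion x (Fract [:\<alpha>, \<beta>:] (pole_poly N)))
      (0 - (if Aff a \<in> N then 1 else 0)) (line_form \<alpha> \<beta> (Aff a) / inverse (value_factor N (Aff a)))"
      using Aff fin value_factor_nonzero[OF fin] by (simp add: diff_expansion_Aff del: fls_eval_pCons)
    then show ?thesis using Aff by (simp add: divide_inverse mult.commute split: if_splits)
  next
    case Infty
    define m where "m = Polynomial.degree (pole_poly N)"
    \<comment> \<open>Order at infinity: the numerator contributes -1, the denominator
      \<open>m\<close> and \<open>dz\<close> contributes -2, in total \<open>m - 3\<close>.\<close>
    have m: "int m = (if Infty \<in> N then 2 else 3)"
      using degree_pole_poly[OF fin] N fin by (auto simp: m_def)
    have "has_lead (fls_eval fls_X_inv [:\<alpha>, \<beta>:]) (- 1) \<beta>"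
      using has_lead_eval_Infty[of "[:\<alpha>, \<beta>:]" 1] by simp
    moreover have "has_lead (fls_eval fls_X_inv (pole_poly N)) (- int m) 1"
      using has_lead_eval_Infty[of "pole_poly N" m] lead_coeff_pole_poly[of N] by (simp add: m_def)
    moreover have "has_lead (fls_X_inv\<^sup>2) (- 2) (1 :: 'a)"
      by (simp add: has_lead_def)
    ultimately have "has_lead (- (fls_eval fls_X_inv [:\<alpha>, \<beta>:] / fls_eval fls_X_inv (pole_poly N)
      * fls_X_inv\<^sup>2)) (((- 1) - (- int m)) + (- 2)) (- (\<beta> / 1 * 1))"
      by (intro has_lead_uminus has_lead_mult has_lead_divide) auto
    then show ?thesis using Infty fin m
      by (simp add: diff_expansion_Infty value_factor_def line_form_def del: fls_eval_pCons
            split: if_splits)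
  qed
qed

text \<open>The denominator beyond \<open>pole_poly N\<close> is taken of least degree. A root of it
  would be a pole that is not simple or not in \<open>N\<close>, so it is constant; the order at
  infinity then bounds the degree of the numerator by 1.\<close>

lemma regular_differential_form:
  fixes f :: "'k::alg_closed_field poly fract"
  assumes N: "card N = 3"
    and reg: "\<And>x. fls_subdegree (diff_expansion x f) \<ge> (if x \<in> N then - 1 else 0)"
  shows "\<exists>\<alpha> \<beta>. f = Fract [:\<alpha>, \<beta>:] (pole_poly N)"
proof -
  have fin: "finite N" using N card.infinite by fastforce
  define Q where "Q = pole_poly N"
  have Q: "Q \<noteq> 0" using fin by (simp add: Q_def)
  define rep where "rep = (\<lambda>p q. q \<noteq> 0 \<and> f = Fract p (q * Q))"
  obtain p0 q0 where "q0 \<noteq> 0" "f = Fract p0 q0" using Fract_cases[of f] by metis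
  then have ex: "rep (p0 * Q) q0" using Q by (simp add: rep_def eq_fract)
  define n where "n = (LEAST n. \<exists>p q. rep p q \<and> Polynomial.degree q = n)"
  have "\<exists>p q. rep p q \<and> Polynomial.degree q = n"
    unfolding n_def by (rule LeastI_ex) (use ex in blast)
  then obtain p q where pq: "rep p q" and dq: "Polynomial.degree q = n" by blast
  have min: "n \<le> Polynomial.degree q'" if "rep p' q'" for p' q'
    unfolding n_def by (rule Least_le) (use that in blast)
  have q: "q \<noteq> 0" and f: "f = Fract p (q * Q)" using pq by (auto simp: rep_def)
  show ?thesis
  proof (cases "p = 0")
    case True
    then have "f = Fract [:0, 0:] (pole_poly N)"
      using f q Q fin by (simp add: eq_fract)
    then show ?thesis by blast
  next
    case p: False
    have "Polynomial.degree q = 0"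
    proof (rule ccontr)
      assume "Polynomial.degree q \<noteq> 0"
      then obtain a where a: "poly q a = 0" using alg_closed_imp_poly_has_root[of q] by auto
      \<comment> \<open>A common root could be cancelled, against minimality.\<close>
      have pa: "poly p a \<noteq> 0"
      proof
        assume "poly p a = 0"
        then obtain p1 q1 where p1: "p = [:- a, 1:] * p1" and q1: "q = [:- a, 1:] * q1"
          using a by (auto simp: poly_eq_0_iff_dvd dvd_def)
        have q1nz: "q1 \<noteq> 0" using q q1 by auto
        have "rep p1 q1" unfolding rep_def f
          using q1nz p1 q1 q Q by (simp add: eq_fract del: mult_pCons_left mult_pCons_right)
        moreover have "Polynomial.degree q = Suc (Polynomial.degree q1)" using q1nz degree_mult_eq[of "[:- a, 1:]" q1] unfolding q1 by simp
        ultimately show False using min[of p1 q1] dq by simp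
      qed
      have "Polynomial.order a q \<noteq> 0" using a q order_root by blast
      moreover obtain c where "c \<noteq> 0"
        and c: "has_lead (fls_eval (fls_const a + fls_X) q) (int (Polynomial.order a q)) c"
        using has_lead_eval_Aff_order[OF q] by blast
      moreover have "has_lead (fls_eval (fls_const a + fls_X) p / (fls_eval (fls_const a + fls_X) q
          * fls_eval (fls_const a + fls_X) Q)) (0 - (int (Polynomial.order a q) + (if Aff a \<in> N then 1 else 0)))
          (poly p a / (c * inverse (value_factor N (Aff a))))"
        unfolding Q_def using value_factor_nonzero[OF fin] \<open>c \<noteq> 0\<close>
        by (intro has_lead_divide has_lead_mult has_lead_eval_Aff c has_lead_pole_poly fin) auto
      ultimately have "fls_subdegree (diff_expansion (Aff a) f)
        = 0 - (int (Polynomial.order a q) + (if Aff a \<in> N then 1 else 0))"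
        using f q Q pa value_factor_nonzero[OF fin, of "Aff a"]
        by (intro has_lead_subdegree[where c = "poly p a / (c * inverse (value_factor N (Aff a)))"])
          (auto simp: diff_expansion_Aff fls_eval_mult)
      with \<open>Polynomial.order a q \<noteq> 0\<close> reg[of "Aff a"] show False by (auto split: if_splits)
    qed
    then obtain d where d: "q = [:d:]" by (auto elim: degree_eq_zeroE)
    with q have dnz: "d \<noteq> 0" by auto
    define P where "P = Polynomial.smult (inverse d) p"
    have fP: "f = Fract P Q" using f q Q dnz d by (simp add: eq_fract P_def)
    have P: "P \<noteq> 0" using p dnz by (simp add: P_def)
    have m: "int (Polynomial.degree Q) = (if Infty \<in> N then 2 else 3)"
      using degree_pole_poly[OF fin] N fin by (auto simp: Q_def)
    have "has_lead (- (fls_eval fls_X_inv P / fls_eval fls_X_inv Q * fls_X_inv\<^sup>2))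
      (((- int (Polynomial.degree P)) - (- int (Polynomial.degree Q))) + (- 2)) (- (lead_coeff P / lead_coeff Q * 1))"
      using Q by (intro has_lead_uminus has_lead_mult has_lead_divide has_lead_eval_Infty)
        (auto simp: has_lead_def)
    then have "fls_subdegree (diff_expansion Infty f) = - int (Polynomial.degree P) + int (Polynomial.degree Q) - 2"
      using fP Q P by (subst has_lead_subdegree) (auto simp: diff_expansion_Infty)
    \<comment> \<open>\<open>deg Q - deg P - 2\<close> is at least -1 when \<open>Q\<close> has
      degree 2 and at least 0 when it has degree 3; both mean \<open>deg P <= 1\<close>.\<close>
    then have "Polynomial.degree P \<le> 1" using reg[of Infty] m by (auto split: if_splits)
    then have "P = [:Polynomial.coeff P 0, Polynomial.coeff P 1:]"
      by (intro poly_eqI) (auto simp: coeff_pCons coeff_eq_0 split: nat.splits)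
    then show ?thesis using fP unfolding Q_def by metis
  qed
qed

text \<open>Verified by computation in the only two configurations up to order: three finite poles,
  or two finite poles and infinity.\<close>

lemma residue_theorem:
  assumes "card N = 3"
  shows "(\<Sum>x\<in>N. value_factor N x * line_form \<alpha> \<beta> x) = 0"
proof -
  obtain x y z where N: "N = {x, y, z}" and d: "x \<noteq> y" "x \<noteq> z" "y \<noteq> z"
    using assms by (auto simp: card_3_iff)
  \<comment> \<open>Moves each summand separately to the denominator
    \<open>(a - b) * (a - c) * (b - c)\<close>, after which the numerators cancel.\<close>
  have frac: "inverse p * q = r / s" if "p \<noteq> 0" "s \<noteq> 0" "q * s = r * p" for p q r s :: 'a
    using that by (simp add: field_simps)
  have aff: "?thesis" if "N = {Aff a, Aff b, Aff c}" "a \<noteq> b" "a \<noteq> c" "b \<noteq> c" for a b c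
  proof -
    have S: "{u. Aff u \<in> N} = {a, b, c}" using that by auto
    have "{a, b, c} - {a} = {b, c}" "{a, b, c} - {b} = {a, c}" "{a, b, c} - {c} = {a, b}"
      using that by auto
    then have "(\<Sum>x\<in>N. value_factor N x * line_form \<alpha> \<beta> x)
      = inverse ((a - b) * (a - c)) * (\<alpha> + a * \<beta>) + (inverse ((b - a) * (b - c)) * (\<alpha> + b * \<beta>)
        + inverse ((c - a) * (c - b)) * (\<alpha> + c * \<beta>))"
      using that unfolding value_factor_def line_form_def S by simp
    also have "inverse ((a - b) * (a - c)) * (\<alpha> + a * \<beta>)
      = ((\<alpha> + a * \<beta>) * (b - c)) / ((a - b) * (a - c) * (b - c))"
      by (rule frac; (use that in force | simp add: algebra_simps; fail))
    also have "inverse ((b - a) * (b - c)) * (\<alpha> + b * \<beta>)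
      = (- (\<alpha> + b * \<beta>) * (a - c)) / ((a - b) * (a - c) * (b - c))"
      by (rule frac; (use that in force | simp add: algebra_simps; fail))
    also have "inverse ((c - a) * (c - b)) * (\<alpha> + c * \<beta>)
      = ((\<alpha> + c * \<beta>) * (a - b)) / ((a - b) * (a - c) * (b - c))"
      by (rule frac; (use that in force | simp add: algebra_simps; fail))
    finally show ?thesis
      by (simp only: add_divide_distrib[symmetric]) (simp add: algebra_simps)
  qed
  have inf: "?thesis" if "N = {Aff a, Aff b, Infty}" "a \<noteq> b" for a b
  proof -
    have S: "{u. Aff u \<in> N} = {a, b}" using that by auto
    have "{a, b} - {a} = {b}" "{a, b} - {b} = {a}" using that by auto
    then show ?thesis using that unfolding value_factor_def line_form_def S
      by (simp add: field_simps)
  qed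
  show ?thesis
  proof (cases x)
    case (Aff a)
    show ?thesis
    proof (cases y)
      case (Aff b)
      show ?thesis
        by (cases z) (use \<open>x = Aff a\<close> Aff N d aff inf in auto)
    next
      case Infty
      then obtain c where "z = Aff c" using d by (cases z) auto
      then show ?thesis using \<open>x = Aff a\<close> Infty N d inf[of a c] by (auto simp: insert_commute)
    qed
  next
    case Infty
    then obtain b c where "y = Aff b" "z = Aff c" using d by (cases y; cases z) auto
    then show ?thesis using Infty N d inf[of b c] by (auto simp: insert_commute)
  qed
qed

lemma line_form_interpolation:
  assumes "x \<noteq> y"
  shows "\<exists>\<alpha> \<beta>. line_form \<alpha> \<beta> x = r \<and> line_form \<alpha> \<beta> y = s"
proof -
  have aff: "\<exists>\<alpha> \<beta>. \<alpha> + a * \<beta> = r \<and> \<alpha> + b * \<beta> = s" if "a \<noteq> b" for a b r s :: 'a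
  proof (intro exI conjI)
    show "(r - a * ((r - s) / (a - b))) + a * ((r - s) / (a - b)) = r" by simp
    have "(r - s) / (a - b) * (a - b) = r - s" using that by simp
    then show "(r - a * ((r - s) / (a - b))) + b * ((r - s) / (a - b)) = s"
      by (simp only: right_diff_distrib) (simp add: algebra_simps)
  qed
  have inf: "\<exists>\<alpha>. \<alpha> + a * s = r" for a r s :: 'a
    by (rule exI[of _ "r - a * s"]) simp
  show ?thesis using assms
    by (cases x; cases y) (auto simp: line_form_def aff inf conj_commute)
qed

text \<open>Two residues fix the form by interpolation, and the residue theorem forces the
  third.\<close>

lemma exists_form_with_residues:
  assumes N: "card N = 3" and sum: "(\<Sum>x\<in>N. \<phi> x) = 0"
  shows "\<exists>\<alpha> \<beta>. \<forall>x\<in>N. value_factor N x * line_form \<alpha> \<beta> x = \<phi> x"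
proof -
  obtain x y z where xyz: "N = {x, y, z}" and d: "x \<noteq> y" "x \<noteq> z" "y \<noteq> z"
    using N by (auto simp: card_3_iff)
  have fin: "finite N" by (simp add: xyz)
  obtain \<alpha> \<beta> where ab: "line_form \<alpha> \<beta> x = \<phi> x / value_factor N x"
    "line_form \<alpha> \<beta> y = \<phi> y / value_factor N y"
    using line_form_interpolation[OF d(1)] by metis
  have xy: "value_factor N x * line_form \<alpha> \<beta> x = \<phi> x" "value_factor N y * line_form \<alpha> \<beta> y = \<phi> y"
    using ab value_factor_nonzero[OF fin] by auto
  have "(\<Sum>u\<in>N. value_factor N u * line_form \<alpha> \<beta> u - \<phi> u) = 0"
    using residue_theorem[OF N, of \<alpha> \<beta>] sum by (simp add: sum_subtractf)
  then have "value_factor N z * line_form \<alpha> \<beta> z = \<phi> z"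
    using d xy by (subst (asm) (2) xyz) simp
  with xy show ?thesis by (intro exI[of _ \<alpha>] exI[of _ \<beta>]) (auto simp: xyz[THEN eqset_imp_iff])
qed

section \<open>Generic points on a family of lines\<close>

definition independent_family ::
    "('a::zero \<Rightarrow> 'b::comm_monoid_add \<Rightarrow> 'b) \<Rightarrow> ('i \<Rightarrow> 'b) \<Rightarrow> 'i set \<Rightarrow> bool" where
  "independent_family scale v A \<longleftrightarrow>
     (\<forall>c. (\<Sum>i\<in>A. scale (c i) (v i)) = 0 \<longrightarrow> (\<forall>i\<in>A. c i = 0))"

context vector_space
begin

section \<open>Dimension and independence of finite families\<close>

lemma dim_insert_finite:
  assumes "finite S"
  shows "dim (insert v S) = (if v \<in> span S then dim S else Suc (dim S))"
proof (cases "v \<in> span S")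
  case True
  then show ?thesis by (metis dim_span span_redundant)
next
  case False
  obtain B where B: "B \<subseteq> S" "independent B" "S \<subseteq> span B" "card B = dim S"
    by (rule basis_exists)
  have eq: "span B = span S"
    using B by (metis span_mono span_minimal subspace_span subset_antisym)
  have "finite B" using B(1) assms finite_subset by blast
  moreover have "v \<notin> B" using False B(1) span_superset by blast
  ultimately have "card (insert v B) = Suc (dim S)" using B(4) by simp
  moreover have "independent (insert v B)" using False eq B(2) by (simp add: independent_insertI)
  moreover have "span (insert v B) = span (insert v S)"
    using eq by (metis span_insert)
  ultimately show ?thesis using False by (metis dim_eq_card)
qed

lemma dim_mono_finite:
  assumes "finite T" "S \<subseteq> span T"
  shows "dim S \<le> dim T"
proof -
  obtain B where B: "B \<subseteq> S" "independent B" "card B = dim S" by (metis basis_exists)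
  obtain C where C: "C \<subseteq> T" "T \<subseteq> span C" "card C = dim T" by (metis basis_exists)
  have "finite C" using C(1) assms(1) finite_subset by blast
  moreover have "B \<subseteq> span C"
    using B(1) assms(2) C(2) by (meson order_trans span_minimal subspace_span)
  ultimately show ?thesis using independent_span_bound[of C B] B C by auto
qed

lemma independent_if_card_le_dim:
  assumes "finite S" "card S \<le> dim S"
  shows "independent S"
proof
  assume "dependent S"
  then obtain x where x: "x \<in> S" "x \<in> span (S - {x})" by (auto simp: dependent_def)
  then have "S \<subseteq> span (S - {x})"
    using span_superset[of "S - {x}"] by blast
  then have "dim S \<le> card (S - {x})" using assms(1) by (intro dim_le_card) auto
  then show False using x(1) assms card_Diff1_less[of S x] by simp
qed

lemma independent_family_if_card_le_dim:
  assumes A: "finite A" and le: "card A \<le> dim (v ` A)"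
  shows "independent_family scale v A"
proof -
  have "dim (v ` A) \<le> card (v ` A)" using A by (intro dim_le_card span_superset) simp
  then have "card (v ` A) = card A" using le card_image_le[OF A, of v] by simp
  then have inj: "inj_on v A" using A by (simp add: eq_card_imp_inj_on)
  have ind: "independent (v ` A)"
    using A le \<open>card (v ` A) = card A\<close> by (intro independent_if_card_le_dim) auto
  show ?thesis unfolding independent_family_def
  proof (intro allI impI)
    fix c assume "(\<Sum>i\<in>A. scale (c i) (v i)) = 0"
    then have "(\<Sum>x\<in>v ` A. scale (c (the_inv_into A v x)) x) = 0"
      by (simp add: sum.reindex[OF inj] the_inv_into_f_f[OF inj])
    then have "\<forall>x\<in>v ` A. c (the_inv_into A v x) = 0"
      using independentD[OF ind _ subset_refl, of "\<lambda>x. c (the_inv_into A v x)"] A by auto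
    then show "\<forall>i\<in>A. c i = 0" by (simp add: the_inv_into_f_f[OF inj])
  qed
qed

lemma independent_family_inj_on:
  assumes A: "finite A" and ind: "independent_family scale v A"
  shows "inj_on v A"
proof (rule inj_onI, rule ccontr)
  fix i j assume ij: "i \<in> A" "j \<in> A" "v i = v j" "i \<noteq> j"
  define c where "c = (\<lambda>k. if k = i then 1 else if k = j then - 1 else (0 :: 'a))"
  have "(\<Sum>k\<in>A. scale (c k) (v k)) = (\<Sum>k\<in>{i, j}. scale (c k) (v k))"
    using A ij by (intro sum.mono_neutral_right) (auto simp: c_def)
  also have "\<dots> = 0" using ij by (simp add: c_def scale_minus_left)
  finally have "c i = 0" using ind ij by (auto simp: independent_family_def)
  then show False by (simp add: c_def)
qed

lemma independent_family_image:
  assumes A: "finite A" and ind: "independent_family scale v A"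
  shows "independent (v ` A)"
proof (rule independent_if_scalars_zero)
  note inj = independent_family_inj_on[OF A ind]
  fix f x assume s: "(\<Sum>x\<in>v ` A. scale (f x) x) = 0" and x: "x \<in> v ` A"
  have "(\<Sum>i\<in>A. scale (f (v i)) (v i)) = 0" using s by (simp add: sum.reindex[OF inj])
  then show "f x = 0" using ind x unfolding independent_family_def by auto
qed (use A in simp)

lemma dim_independent_family:
  "finite A \<Longrightarrow> independent_family scale v A \<Longrightarrow> dim (v ` A) = card A"
  by (metis card_image dim_eq_card_independent independent_family_image independent_family_inj_on)

section \<open>Linear functionals in general position\<close>

lemma vector_space_pair_self: "vector_space_pair scale ((*) :: 'a \<Rightarrow> 'a \<Rightarrow> 'a)"
  by unfold_locales (simp_all add: algebra_simps)

lemma exists_functional_separating: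
  assumes "x \<notin> span S"
  shows "\<exists>h. Vector_Spaces.linear scale (*) h \<and> (\<forall>s\<in>span S. h s = 0) \<and> h x \<noteq> 0"
proof -
  interpret vp: vector_space_pair scale "(*) :: 'a \<Rightarrow> 'a \<Rightarrow> 'a" by (rule vector_space_pair_self)
  obtain B where B: "B \<subseteq> S" "independent B" "S \<subseteq> span B" by (metis basis_exists)
  have eq: "span B = span S"
    using B by (metis span_mono span_minimal subspace_span subset_antisym)
  have "independent (insert x B)" using assms eq B(2) by (simp add: independent_insertI)
  then obtain h where h: "Vector_Spaces.linear scale (*) h" "\<forall>y\<in>insert x B. h y = (if y = x then 1 else 0)"
    using vp.linear_independent_extend[of "insert x B" "\<lambda>y. if y = x then 1 else 0"] by blast
  have "x \<notin> B" using assms eq span_superset[of B] by auto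
  then have "\<And>y. y \<in> B \<Longrightarrow> h y = 0" using h(2) by auto
  then have "\<forall>s\<in>span S. h s = 0"
    using vp.linear_eq_0_on_span[OF h(1), of B] eq by blast
  then show ?thesis using h by auto
qed

text \<open>Adding \<open>t * k\<close>, where \<open>k\<close> separates the new vector from the
  span, spoils at most one \<open>t\<close> for each vector; an infinite field leaves a good
  \<open>t\<close>.\<close>

lemma exists_functional_nonvanishing:
  assumes inf: "infinite (UNIV :: 'a set)" and "finite I"
    and "\<And>i. i \<in> I \<Longrightarrow> u i \<notin> span S"
  shows "\<exists>h. Vector_Spaces.linear scale (*) h \<and> (\<forall>s\<in>span S. h s = 0) \<and> (\<forall>i\<in>I. h (u i) \<noteq> 0)"
  using assms(2,3)
proof (induction I rule: finite_induct)
  case empty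
  interpret vp: vector_space_pair scale "(*) :: 'a \<Rightarrow> 'a \<Rightarrow> 'a" by (rule vector_space_pair_self)
  show ?case using vp.linear_zero by (intro exI[of _ "\<lambda>_. 0"]) auto
next
  case (insert j I)
  interpret vp: vector_space_pair scale "(*) :: 'a \<Rightarrow> 'a \<Rightarrow> 'a" by (rule vector_space_pair_self)
  obtain h where h: "Vector_Spaces.linear scale (*) h" "\<forall>s\<in>span S. h s = 0" "\<forall>i\<in>I. h (u i) \<noteq> 0"
    using insert by auto
  obtain k where k: "Vector_Spaces.linear scale (*) k" "\<forall>s\<in>span S. k s = 0" "k (u j) \<noteq> 0"
    using exists_functional_separating[of "u j" S] insert.prems by auto
  have "finite (\<Union>i\<in>insert j I. {- h (u i) / k (u i)})" using insert.hyps by simp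
  from ex_new_if_finite[OF inf this]
  obtain t where t: "\<And>i. i \<in> insert j I \<Longrightarrow> t \<noteq> - h (u i) / k (u i)"
    by blast
  define f where "f = (\<lambda>x. h x + t * k x)"
  have "Vector_Spaces.linear scale (*) f"
    unfolding f_def
    using vp.linear_compose_add[OF h(1) vp.linear_compose_scale_right[OF k(1)]] .
  moreover have "f (u i) \<noteq> 0" if "i \<in> insert j I" for i
  proof
    assume z: "f (u i) = 0"
    show False
    proof (cases "k (u i) = 0")
      case True
      then show ?thesis using that z h(3) k(3) by (auto simp: f_def)
    next
      case False
      then have "t = - h (u i) / k (u i)"
        using z by (simp add: f_def field_simps eq_neg_iff_add_eq_0)
      then show ?thesis using t that by blast
    qed
  qed
  ultimately show ?case using h(2) k(2) by (intro exI[of _ f]) (auto simp: f_def)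
qed

text \<open>Two different parameters would put a nonzero multiple of \<open>y\<close>, and then also
  \<open>x\<close>, into the span.\<close>

lemma finite_line_param_in_span:
  assumes "\<not> (x \<in> span S \<and> y \<in> span S)"
  shows "finite {t. x + scale t y \<in> span S}"
proof (cases "\<exists>t. x + scale t y \<in> span S")
  case True
  then obtain t where t: "x + scale t y \<in> span S" by blast
  have "s = t" if s: "x + scale s y \<in> span S" for s
  proof (rule ccontr)
    assume "s \<noteq> t"
    have "scale (s - t) y \<in> span S"
      using span_diff[OF s t] by (simp add: scale_left_diff_distrib)
    from span_scale[OF this, of "inverse (s - t)"] have y: "y \<in> span S"
      using \<open>s \<noteq> t\<close> by simp
    have "x \<in> span S" using span_diff[OF t span_scale[OF y, of t]] by simp
    with y assms show False by blast
  qed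
  then have "{t. x + scale t y \<in> span S} \<subseteq> {t}" by blast
  then show ?thesis by (rule finite_subset) simp
qed auto

text \<open>The points are chosen one at a time.  Requiring the inequality for \<open>B\<close> together with one more
  line \<open>i\<close> keeps every line, even those already treated, out of the final span.\<close>

lemma exists_generic_points_on_lines:
  fixes a b :: "'i \<Rightarrow> 'b"
  assumes inf: "infinite (UNIV :: 'a set)" and A: "finite A"
    and dim: "\<And>B. B \<subseteq> A \<Longrightarrow> B \<noteq> {} \<Longrightarrow> card B + 1 \<le> dim (a ` B \<union> b ` B)"
    and P: "P \<subseteq> A"
  shows "\<exists>t. \<forall>B i. B \<subseteq> A - P \<longrightarrow> i \<in> A \<longrightarrow> card P + card B + 1
    \<le> dim ((\<lambda>i. a i + scale (t i) (b i)) ` P \<union> (a ` B \<union> b ` B) \<union> {a i, b i})"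
  using finite_subset[OF P A] P
proof (induction P rule: finite_induct)
  case empty
  have "card B + 1 \<le> dim (a ` B \<union> b ` B \<union> {a i, b i})" if "B \<subseteq> A" "i \<in> A" for B i
  proof -
    have fin: "finite B" using that A finite_subset by blast
    have "card B \<le> card (insert i B)" using fin by (simp add: card_insert_le)
    moreover have "card (insert i B) + 1 \<le> dim (a ` insert i B \<union> b ` insert i B)"
      using that by (intro dim) auto
    moreover have "a ` insert i B \<union> b ` insert i B = a ` B \<union> b ` B \<union> {a i, b i}" by auto
    ultimately show ?thesis by simp
  qed
  then show ?case by simp
next
  case (insert j P)
  then obtain t where t: "\<And>B i. B \<subseteq> A - P \<Longrightarrow> i \<in> A \<Longrightarrow> card P + card B + 1
      \<le> dim ((\<lambda>i. a i + scale (t i) (b i)) ` P \<union> (a ` B \<union> b ` B) \<union> {a i, b i})"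
    by auto
  define v where "v = (\<lambda>i. a i + scale (t i) (b i))"
  define X where "X = (\<lambda>B i. v ` P \<union> (a ` B \<union> b ` B) \<union> {a i, b i})"
  have finX: "finite (X B i)" if "B \<subseteq> A" for B i
    using that A insert.hyps(1) finite_subset[of B A] by (auto simp: X_def)
  \<comment> \<open>Only where the inequality is tight must the new point raise the dimension;
    elsewhere there is one dimension to spare.\<close>
  define bad where "bad = (\<lambda>B i. if dim (X B i) \<le> card P + card B + 1
    then {s. a j + scale s (b j) \<in> span (X B i)} else {})"
  have "finite (bad B i)" if B: "B \<subseteq> A - insert j P" and i: "i \<in> A" for B i
  proof (cases "dim (X B i) \<le> card P + card B + 1")
    case True
    have fB: "finite B" using B A finite_subset by blast
    \<comment> \<open>If the whole line \<open>j\<close> lay in the span, replacing \<open>B\<close>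
      by \<open>insert j B\<close> would not raise the dimension, against the induction hypothesis
      for \<open>insert j B\<close>, whose bound is one higher.\<close>
    have "\<not> (a j \<in> span (X B i) \<and> b j \<in> span (X B i))"
    proof
      assume in': "a j \<in> span (X B i) \<and> b j \<in> span (X B i)"
      have "X (insert j B) i = insert (a j) (insert (b j) (X B i))" by (auto simp: X_def)
      also have "dim \<dots> = dim (X B i)"
        using in' span_mono[of "X B i" "insert (b j) (X B i)"]
        by (intro span_eq_dim) (auto simp: span_redundant)
      finally have "dim (X (insert j B) i) \<le> card P + card B + 1" using True by simp
      moreover have "card P + card (insert j B) + 1 \<le> dim (X (insert j B) i)"
        unfolding X_def v_def using B i insert.prems insert.hyps by (intro t) auto
      moreover have "j \<notin> B" using B by auto
      ultimately show False using fB by simp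
    qed
    from finite_line_param_in_span[OF this] show ?thesis by (simp add: bad_def)
  qed (simp add: bad_def)
  moreover have "finite {B. B \<subseteq> A - insert j P}" using A by simp
  ultimately have "finite (\<Union>B\<in>{B. B \<subseteq> A - insert j P}. \<Union>i\<in>A. bad B i)"
    using A by (intro finite_UN_I) auto
  from ex_new_if_finite[OF inf this]
  obtain s where s: "\<And>B i. B \<subseteq> A - insert j P \<Longrightarrow> i \<in> A \<Longrightarrow> s \<notin> bad B i"
    by auto
  have "card (insert j P) + card B + 1 \<le> dim ((\<lambda>i. a i + scale ((t(j := s)) i) (b i)) ` insert j P
      \<union> (a ` B \<union> b ` B) \<union> {a i, b i})" if B: "B \<subseteq> A - insert j P" and i: "i \<in> A" for B i
  proof -
    have "(\<lambda>i. a i + scale ((t(j := s)) i) (b i)) ` P = v ` P"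
      using insert.hyps(2) by (auto simp: v_def)
    then have "(\<lambda>i. a i + scale ((t(j := s)) i) (b i)) ` insert j P \<union> (a ` B \<union> b ` B) \<union> {a i, b i}
      = insert (a j + scale s (b j)) (X B i)" by (auto simp: X_def)
    moreover have "card P + card B + 1 \<le> dim (X B i)"
      unfolding X_def v_def using B i by (intro t) auto
    moreover have "finite (X B i)" using B by (intro finX) auto
    moreover have "a j + scale s (b j) \<notin> span (X B i)" if "dim (X B i) \<le> card P + card B + 1"
      using s[OF B i] that by (simp add: bad_def)
    ultimately show ?thesis using insert.hyps
      by (cases "dim (X B i) \<le> card P + card B + 1") (auto simp: dim_insert_finite)
  qed
  then show ?case by blast
qed

text \<open>The vector \<open>h(b i) a i - h(a i) b i\<close> represents the intersection of line
  \<open>i\<close> with the hyperplane \<open>h = 0\<close>. The hyperplane is found backwards: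
  independent points \<open>v i\<close> are chosen on the lines with no \<open>b i\<close> in their
  span, and \<open>h\<close> kills all \<open>v i\<close> but no \<open>b i\<close>. Each
  intersection vector is then a nonzero multiple of \<open>v i\<close>.\<close>

lemma exists_generic_functional:
  fixes a b :: "'i \<Rightarrow> 'b"
  assumes inf: "infinite (UNIV :: 'a set)" and A: "finite A"
    and dim: "\<And>B. B \<subseteq> A \<Longrightarrow> B \<noteq> {} \<Longrightarrow> card B + 1 \<le> dim (a ` B \<union> b ` B)"
  shows "\<exists>h. Vector_Spaces.linear scale (*) h
    \<and> independent_family scale (\<lambda>i. scale (h (b i)) (a i) - scale (h (a i)) (b i)) A"
proof -
  interpret vp: vector_space_pair scale "(*) :: 'a \<Rightarrow> 'a \<Rightarrow> 'a" by (rule vector_space_pair_self)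
  have "\<exists>t. \<forall>B i. B \<subseteq> A - A \<longrightarrow> i \<in> A \<longrightarrow> card A + card B + 1
      \<le> dim ((\<lambda>i. a i + scale (t i) (b i)) ` A \<union> (a ` B \<union> b ` B) \<union> {a i, b i})"
    by (rule exists_generic_points_on_lines[OF inf A _ subset_refl]) (rule dim)
  then obtain t where t': "\<And>B i. B \<subseteq> A - A \<Longrightarrow> i \<in> A \<Longrightarrow> card A + card B + 1
      \<le> dim ((\<lambda>i. a i + scale (t i) (b i)) ` A \<union> (a ` B \<union> b ` B) \<union> {a i, b i})"
    by blast
  have t: "card A + 1 \<le> dim ((\<lambda>i. a i + scale (t i) (b i)) ` A \<union> {a i, b i})" if "i \<in> A" for i
    using t'[of "{}" i] that by simp
  define v where "v = (\<lambda>i. a i + scale (t i) (b i))"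
  have dv: "dim (v ` A) \<le> card A"
    using A by (meson card_image_le dim_le_card finite_imageI order_trans span_superset)
  \<comment> \<open>Since \<open>a i\<close> is a combination of \<open>v i\<close> and
    \<open>b i\<close>, adjoining all of line \<open>i\<close> to the points adds at most one
    dimension. The bound for \<open>B = {}\<close> demands that it does add one, and that the points
    already have full rank.\<close>
  have ge: "card A \<le> dim (v ` A) \<and> b i \<notin> span (v ` A)" if i: "i \<in> A" for i
  proof -
    have "v i \<in> span (insert (b i) (v ` A))" "b i \<in> span (insert (b i) (v ` A))"
      using i by (auto intro: span_base)
    then have "v i - scale (t i) (b i) \<in> span (insert (b i) (v ` A))"
      by (intro span_diff span_scale)
    then have "a i \<in> span (insert (b i) (v ` A))" by (simp add: v_def)
    moreover have "insert (b i) (v ` A) \<subseteq> span (insert (b i) (v ` A))" by (rule span_superset)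
    ultimately have "v ` A \<union> {a i, b i} \<subseteq> span (insert (b i) (v ` A))" by blast
    then have "dim (v ` A \<union> {a i, b i}) \<le> dim (insert (b i) (v ` A))"
      using A by (intro dim_mono_finite) auto
    moreover have "card A + 1 \<le> dim (v ` A \<union> {a i, b i})" using t[OF i] unfolding v_def .
    ultimately have "card A + 1 \<le> dim (insert (b i) (v ` A))" by linarith
    then show ?thesis using dv A by (simp add: dim_insert_finite split: if_splits)
  qed
  have ind: "independent_family scale v A"
  proof (cases "A = {}")
    case False
    then show ?thesis using ge A independent_family_if_card_le_dim by blast
  qed (simp add: independent_family_def)
  obtain h where h: "Vector_Spaces.linear scale (*) h" "\<forall>s\<in>span (v ` A). h s = 0" "\<forall>i\<in>A. h (b i) \<noteq> 0"
    using exists_functional_nonvanishing[OF inf A, of b "v ` A"] ge by blast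
  have w: "scale (h (b i)) (a i) - scale (h (a i)) (b i) = scale (h (b i)) (v i)" if "i \<in> A" for i
  proof -
    have "h (v i) = 0" using h(2) that by (simp add: span_base)
    then have "h (a i) = - (h (b i) * t i)"
      using vp.linear_add[OF h(1)] vp.linear_scale[OF h(1)]
      by (simp add: v_def eq_neg_iff_add_eq_0 mult.commute)
    then show ?thesis by (simp add: v_def scale_right_distrib)
  qed
  have "independent_family scale (\<lambda>i. scale (h (b i)) (a i) - scale (h (a i)) (b i)) A"
    unfolding independent_family_def
  proof (intro allI impI)
    fix c assume c: "(\<Sum>i\<in>A. scale (c i) (scale (h (b i)) (a i) - scale (h (a i)) (b i))) = 0"
    have "(\<Sum>i\<in>A. scale (c i * h (b i)) (v i))
      = (\<Sum>i\<in>A. scale (c i) (scale (h (b i)) (a i) - scale (h (a i)) (b i)))"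
      by (intro sum.cong) (simp_all add: w)
    then have "\<forall>i\<in>A. c i * h (b i) = 0"
      using ind[unfolded independent_family_def, rule_format, of "\<lambda>i. c i * h (b i)"] c by simp
    then show "\<forall>i\<in>A. c i = 0" using h(3) by simp
  qed
  then show ?thesis using h(1) by blast
qed

text \<open>Coordinate functionals of the family; they turn independence of long vectors into the
  nonvanishing of a square determinant.\<close>

lemma exists_dual_functionals:
  assumes A: "finite A" and ind: "independent_family scale v A"
  shows "\<exists>T. \<forall>i\<in>A. Vector_Spaces.linear scale (*) (T i) \<and> (\<forall>j\<in>A. T i (v j) = (if i = j then 1 else 0))"
proof -
  interpret vp: vector_space_pair scale "(*) :: 'a \<Rightarrow> 'a \<Rightarrow> 'a" by (rule vector_space_pair_self)
  have "\<exists>h. Vector_Spaces.linear scale (*) h \<and> (\<forall>j\<in>A. h (v j) = (if i = j then 1 else 0))" if i: "i \<in> A" for i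
  proof -
    obtain h where h: "Vector_Spaces.linear scale (*) h" "\<forall>x\<in>v ` A. h x = (if x = v i then 1 else 0)"
      using vp.linear_independent_extend[OF independent_family_image[OF A ind],
          of "\<lambda>x. if x = v i then 1 else 0"] by blast
    have "h (v j) = (if i = j then 1 else 0)" if "j \<in> A" for j
      using h(2) inj_onD[OF independent_family_inj_on[OF A ind], of i j] i that by auto
    with h(1) show ?thesis by blast
  qed
  then show ?thesis by metis
qed

end

section \<open>Polynomial conditions on hyperplanes\<close>

text \<open>Coordinate vectors of length \<open>n\<close> are kept as functions vanishing from
  \<open>n\<close> on, so that they all live in one vector space in which span and dimension do not
  refer to \<open>n\<close>.\<close>

definition fun_scale :: "'k::field \<Rightarrow> (nat \<Rightarrow> 'k) \<Rightarrow> nat \<Rightarrow> 'k" where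
  "fun_scale c f = (\<lambda>j. c * f j)"

interpretation fun_space: vector_space "fun_scale :: 'k::field \<Rightarrow> (nat \<Rightarrow> 'k) \<Rightarrow> nat \<Rightarrow> 'k"
  by unfold_locales (simp_all add: fun_scale_def fun_eq_iff algebra_simps)

interpretation fun_functional: vector_space_pair
    "fun_scale :: 'k::field \<Rightarrow> (nat \<Rightarrow> 'k) \<Rightarrow> nat \<Rightarrow> 'k" "(*) :: 'k \<Rightarrow> 'k \<Rightarrow> 'k"
  by (rule fun_space.vector_space_pair_self)

definition pairing :: "nat \<Rightarrow> 'k::field vec \<Rightarrow> (nat \<Rightarrow> 'k) \<Rightarrow> 'k" where
  "pairing n h f = (\<Sum>j<n. vec_index h j * f j)"

text \<open>The values of an abstract functional on the unit vectors are the coefficients of a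
  concrete hyperplane.\<close>

lemma pairing_eq_functional:
  assumes lin: "Vector_Spaces.linear fun_scale (*) h" and f: "\<And>j. n \<le> j \<Longrightarrow> f j = 0"
  shows "h f = pairing n (vec n (\<lambda>j. h (\<lambda>i. if i = j then 1 else 0))) f"
proof -
  have "(\<Sum>j<m. fun_scale (f j) (\<lambda>i. if i = j then 1 else 0)) i = (if i < m then f i else 0)" for m i
    by (induction m) (auto simp: fun_scale_def less_Suc_eq)
  then have "f = (\<Sum>j<n. fun_scale (f j) (\<lambda>i. if i = j then 1 else 0))"
    using f by (auto simp: fun_eq_iff not_less)
  then have "h f = h (\<Sum>j<n. fun_scale (f j) (\<lambda>i. if i = j then 1 else 0))" by simp
  also have "\<dots> = (\<Sum>j<n. f j * h (\<lambda>i. if i = j then 1 else 0))"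
    by (simp add: fun_functional.linear_sum[OF lin] fun_functional.linear_scale[OF lin])
  finally show ?thesis by (simp add: pairing_def mult.commute)
qed

section \<open>Polynomial functions and their nonvanishing\<close>

lemma poly_funs_cmult: "f \<in> poly_funs n \<Longrightarrow> (\<lambda>x. c * f x) \<in> poly_funs n"
  by (rule poly_funs.mult[OF poly_funs.const])

lemma poly_funs_diff:
  assumes "f \<in> poly_funs n" "g \<in> poly_funs n"
  shows "(\<lambda>x. f x - g x) \<in> poly_funs n"
  using poly_funs.add[OF assms(1) poly_funs_cmult[OF assms(2), of "- 1"]] by simp

lemma poly_funs_sum:
  "(\<And>i. i \<in> I \<Longrightarrow> f i \<in> poly_funs n) \<Longrightarrow> (\<lambda>x. \<Sum>i\<in>I. f i x) \<in> poly_funs n"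
  by (induction I rule: infinite_finite_induct) (auto intro: poly_funs.const poly_funs.add)

lemma poly_funs_prod:
  "(\<And>i. i \<in> I \<Longrightarrow> f i \<in> poly_funs n) \<Longrightarrow> (\<lambda>x. \<Prod>i\<in>I. f i x) \<in> poly_funs n"
  by (induction I rule: infinite_finite_induct) (auto intro: poly_funs.const poly_funs.mult)

lemma poly_funs_pairing: "(\<lambda>h. pairing n h f) \<in> poly_funs n"
  unfolding pairing_def
  by (intro poly_funs_sum poly_funs.mult[OF poly_funs.coord poly_funs.const]) simp

lemma poly_funs_det:
  assumes "\<And>i j. i < m \<Longrightarrow> j < m \<Longrightarrow> f i j \<in> poly_funs n"
  shows "(\<lambda>x. det (mat m m (\<lambda>(i, j). f i j x))) \<in> poly_funs n"
proof -
  \<comment> \<open>Leibniz formula. A permutation of \<open>{0..<m}\<close> never meets the default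
    0, which makes every factor a polynomial function without a side condition on
    \<open>p\<close>.\<close>
  have "(\<lambda>x. det (mat m m (\<lambda>(i, j). f i j x)))
    = (\<lambda>x. \<Sum>p\<in>{p. p permutes {0..<m}}. signof p * (\<Prod>i\<in>{0..<m}. if p i < m then f i (p i) x else 0))"
    by (intro ext) (auto simp: det_def permutes_in_image intro!: sum.cong prod.cong)
  also have "\<dots> \<in> poly_funs n"
    using assms by (intro poly_funs_sum poly_funs_cmult poly_funs_prod) (auto intro: poly_funs.const)
  finally show ?thesis .
qed

lemma poly_funs_on_line:
  assumes "f \<in> poly_funs n"
  shows "\<exists>p. \<forall>t. f (vec n (\<lambda>i. vec_index x i + t * (vec_index y i - vec_index x i))) = poly p t"
  using assms
proof induction
  case (const c)
  then show ?case by (intro exI[of _ "[:c:]"]) simp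
next
  case (coord i)
  then show ?case
    by (intro exI[of _ "[:vec_index x i, vec_index y i - vec_index x i:]"]) simp
next
  case (add f g)
  then obtain p q where "\<forall>t. f (vec n (\<lambda>i. vec_index x i + t * (vec_index y i - vec_index x i))) = poly p t"
    "\<forall>t. g (vec n (\<lambda>i. vec_index x i + t * (vec_index y i - vec_index x i))) = poly q t" by blast
  then show ?case by (intro exI[of _ "p + q"]) simp
next
  case (mult f g)
  then obtain p q where "\<forall>t. f (vec n (\<lambda>i. vec_index x i + t * (vec_index y i - vec_index x i))) = poly p t"
    "\<forall>t. g (vec n (\<lambda>i. vec_index x i + t * (vec_index y i - vec_index x i))) = poly q t" by blast
  then show ?case by (intro exI[of _ "p * q"]) simp
qed

text \<open>On the line joining \<open>x\<close> to \<open>y\<close> both functions become nonzero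
  polynomials in one variable, and their product has finitely many roots.\<close>

lemma poly_funs_mult_nonvanishing:
  fixes f g :: "'k::field vec \<Rightarrow> 'k"
  assumes inf: "infinite (UNIV :: 'k set)"
    and f: "f \<in> poly_funs n" "x \<in> carrier_vec n" "f x \<noteq> 0"
    and g: "g \<in> poly_funs n" "y \<in> carrier_vec n" "g y \<noteq> 0"
  shows "\<exists>z\<in>carrier_vec n. f z * g z \<noteq> 0"
proof -
  define l where "l = (\<lambda>t. vec n (\<lambda>i. vec_index x i + t * (vec_index y i - vec_index x i)))"
  obtain p q where p: "\<And>t. f (l t) = poly p t" and q: "\<And>t. g (l t) = poly q t"
    using poly_funs_on_line[OF f(1), of x y] poly_funs_on_line[OF g(1), of x y]
    unfolding l_def by metis
  have "l 0 = x" "l 1 = y" using f(2) g(2) by (auto simp: l_def)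
  then have "poly p 0 \<noteq> 0" "poly q 1 \<noteq> 0" using p q f(3) g(3) by metis+
  then have "p * q \<noteq> 0" by auto
  then have "finite {t. poly (p * q) t = 0}" by (rule poly_roots_finite)
  then obtain t where "poly (p * q) t \<noteq> 0" using ex_new_if_finite[OF inf] by blast
  then have "f (l t) * g (l t) \<noteq> 0" using p q by simp
  then show ?thesis by (intro bexI[of _ "l t"]) (auto simp: l_def)
qed

lemma homogeneous_poly_funs_prod_nonvanishing:
  fixes F :: "'i \<Rightarrow> 'k::field vec \<Rightarrow> 'k"
  assumes inf: "infinite (UNIV :: 'k set)" and "finite I"
    and "\<And>i. i \<in> I \<Longrightarrow> F i \<in> homogeneous_poly_funs n"
    and "\<And>i. i \<in> I \<Longrightarrow> \<exists>x\<in>carrier_vec n. F i x \<noteq> 0"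
  shows "(\<lambda>x. \<Prod>i\<in>I. F i x) \<in> homogeneous_poly_funs n \<and> (\<exists>x\<in>carrier_vec n. (\<Prod>i\<in>I. F i x) \<noteq> 0)"
  using assms(2-)
proof (induction I rule: finite_induct)
  case empty
  have "(\<lambda>x. 1) \<in> (homogeneous_poly_funs n :: ('k vec \<Rightarrow> 'k) set)"
    unfolding homogeneous_poly_funs_def
    by (rule CollectI, rule conjI[OF poly_funs.const], rule exI[of _ 0]) simp
  moreover have "\<exists>x\<in>(carrier_vec n :: 'k vec set). (1::'k) \<noteq> 0" by (rule bexI[OF _ zero_carrier_vec]) simp
  ultimately show ?case by simp
next
  case (insert i I)
  let ?G = "\<lambda>x. \<Prod>i\<in>I. F i x"
  have G: "?G \<in> homogeneous_poly_funs n" "\<exists>x\<in>carrier_vec n. ?G x \<noteq> 0" using insert by auto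
  have Fi: "F i \<in> homogeneous_poly_funs n" "\<exists>x\<in>carrier_vec n. F i x \<noteq> 0" using insert.prems by auto
  obtain d e where d: "\<forall>c. \<forall>x\<in>carrier_vec n. F i (c \<cdot>\<^sub>v x) = c ^ d * F i x"
    and e: "\<forall>c. \<forall>x\<in>carrier_vec n. ?G (c \<cdot>\<^sub>v x) = c ^ e * ?G x"
    using Fi(1) G(1) unfolding homogeneous_poly_funs_def by blast
  have "\<forall>c. \<forall>x\<in>carrier_vec n. F i (c \<cdot>\<^sub>v x) * ?G (c \<cdot>\<^sub>v x) = c ^ (d + e) * (F i x * ?G x)"
  proof (intro allI ballI)
    fix c :: 'k and x :: "'k vec" assume x: "x \<in> carrier_vec n"
    have "F i (c \<cdot>\<^sub>v x) * ?G (c \<cdot>\<^sub>v x) = (c ^ d * F i x) * (c ^ e * ?G x)"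
      unfolding d[rule_format, OF x] e[rule_format, OF x] ..
    then show "F i (c \<cdot>\<^sub>v x) * ?G (c \<cdot>\<^sub>v x) = c ^ (d + e) * (F i x * ?G x)"
      by (simp only: power_add mult.assoc mult.left_commute)
  qed
  moreover have "(\<lambda>x. F i x * ?G x) \<in> poly_funs n"
    using Fi(1) G(1) by (intro poly_funs.mult) (auto simp: homogeneous_poly_funs_def)
  moreover have "\<exists>x\<in>carrier_vec n. F i x * ?G x \<noteq> 0"
    using poly_funs_mult_nonvanishing[OF inf, of "F i" n _ ?G] Fi G
    by (auto simp: homogeneous_poly_funs_def)
  ultimately show ?case using insert.hyps by (auto simp: homogeneous_poly_funs_def)
qed

text \<open>The point of the line spanned by \<open>a\<close> and \<open>b\<close> on the hyperplane \<open>h\<close>.\<close>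

definition section_point :: "nat \<Rightarrow> 'k::field vec \<Rightarrow> (nat \<Rightarrow> 'k) \<Rightarrow> (nat \<Rightarrow> 'k) \<Rightarrow> nat \<Rightarrow> 'k" where
  "section_point n h a b = fun_scale (pairing n h b) a - fun_scale (pairing n h a) b"

lemma pairing_smult:
  assumes "x \<in> carrier_vec n"
  shows "pairing n (c \<cdot>\<^sub>v x) f = c * pairing n x f"
  unfolding pairing_def sum_distrib_left
proof (rule sum.cong[OF refl])
  fix j assume "j \<in> {..<n}"
  then have "vec_index (c \<cdot>\<^sub>v x) j = c * vec_index x j" using assms by (intro index_smult_vec) simp
  then show "vec_index (c \<cdot>\<^sub>v x) j * f j = c * (vec_index x j * f j)" by (simp only: mult.assoc)
qed

lemma section_point_smult:
  assumes "x \<in> carrier_vec n"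
  shows "section_point n (c \<cdot>\<^sub>v x) a b = fun_scale c (section_point n x a b)"
  by (rule ext)
    (simp only: section_point_def fun_scale_def pairing_smult[OF assms] minus_apply right_diff_distrib mult.assoc)

text \<open>Spreads independence from one hyperplane to an open set. The functionals dual to the
  section points of one good \<open>h\<close> are applied to the section points of a varying
  \<open>x\<close>. The resulting matrix is the identity at \<open>h\<close>, its determinant is a
  form of degree \<open>card A\<close> in \<open>x\<close>, and where it is nonzero the section
  points are independent.\<close>

lemma exists_generic_polynomial:
  fixes a b :: "'i \<Rightarrow> nat \<Rightarrow> 'k::field"
  assumes inf: "infinite (UNIV :: 'k set)" and A: "finite A"
    and supp: "\<And>i j. i \<in> A \<Longrightarrow> n \<le> j \<Longrightarrow> a i j = 0 \<and> b i j = 0"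
    and dim: "\<And>B. B \<subseteq> A \<Longrightarrow> B \<noteq> {} \<Longrightarrow> card B + 1 \<le> fun_space.dim (a ` B \<union> b ` B)"
  shows "\<exists>F\<in>homogeneous_poly_funs n. (\<exists>h\<in>carrier_vec n. F h \<noteq> 0) \<and>
    (\<forall>h\<in>carrier_vec n. F h \<noteq> 0 \<longrightarrow>
      independent_family fun_scale (\<lambda>i. section_point n h (a i) (b i)) A)"
proof -
  have "\<exists>h. Vector_Spaces.linear fun_scale (*) h \<and> independent_family fun_scale
      (\<lambda>i. fun_scale (h (b i)) (a i) - fun_scale (h (a i)) (b i)) A"
  proof (rule fun_space.exists_generic_functional[OF inf A])
    fix B assume "B \<subseteq> A" "B \<noteq> {}"
    then show "card B + 1 \<le> fun_space.dim (a ` B \<union> b ` B)" by (rule dim)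
  qed
  then obtain h0 where lin: "Vector_Spaces.linear fun_scale (*) h0"
    and ind0: "independent_family fun_scale
      (\<lambda>i. fun_scale (h0 (b i)) (a i) - fun_scale (h0 (a i)) (b i)) A"
    using that by (elim exE conjE)
  define h where "h = vec n (\<lambda>j. h0 (\<lambda>i. if i = j then 1 else 0))"
  have "h0 (a i) = pairing n h (a i)" "h0 (b i) = pairing n h (b i)" if "i \<in> A" for i
    unfolding h_def using supp[OF that] by (intro pairing_eq_functional[OF lin]; simp)+
  then have ind: "independent_family fun_scale (\<lambda>i. section_point n h (a i) (b i)) A"
    using ind0 by (simp add: independent_family_def section_point_def cong: sum.cong)
  obtain T where "\<forall>i\<in>A. Vector_Spaces.linear fun_scale (*) (T i) \<and>
      (\<forall>j\<in>A. T i (section_point n h (a j) (b j)) = (if i = j then 1 else 0))"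
    using fun_space.exists_dual_functionals[OF A ind] by blast
  then have T: "\<And>i. i \<in> A \<Longrightarrow> Vector_Spaces.linear fun_scale (*) (T i)"
    "\<And>i j. i \<in> A \<Longrightarrow> j \<in> A \<Longrightarrow> T i (section_point n h (a j) (b j)) = (if i = j then 1 else 0)"
    by simp_all
  define m where "m = card A"
  obtain e where e: "bij_betw e {0..<m} A"
    using ex_bij_betw_nat_finite[OF A] unfolding m_def by (elim exE)
  have eA: "e i \<in> A" if "i < m" for i using bij_betw_apply[OF e, of i] that by simp
  define M where "M = (\<lambda>x. mat m m (\<lambda>(i, j). T (e i) (section_point n x (a (e j)) (b (e j)))))"
  \<comment> \<open>Section points are linear in the coefficients of the hyperplane, so every entry
    is a linear form in \<open>x\<close>.\<close>
  have entry: "T (e i) (section_point n x (a (e j)) (b (e j))) =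
      T (e i) (a (e j)) * pairing n x (b (e j)) - T (e i) (b (e j)) * pairing n x (a (e j))"
    if "i < m" for i j x
    unfolding section_point_def fun_functional.linear_diff[OF T(1)[OF eA[OF that]]]
      fun_functional.linear_scale[OF T(1)[OF eA[OF that]]]
    by (simp only: mult.commute)
  have "(\<lambda>x. det (M x)) \<in> poly_funs n"
    unfolding M_def
  proof (rule poly_funs_det)
    fix i j assume "i < m" "j < m"
    then show "(\<lambda>x. T (e i) (section_point n x (a (e j)) (b (e j)))) \<in> poly_funs n"
      unfolding entry[OF \<open>i < m\<close>] by (intro poly_funs_diff poly_funs_cmult poly_funs_pairing)
  qed
  moreover have "det (M (c \<cdot>\<^sub>v x)) = c ^ m * det (M x)" if "x \<in> carrier_vec n" for c x
  proof -
    have "M (c \<cdot>\<^sub>v x) = c \<cdot>\<^sub>m M x"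
      unfolding M_def section_point_smult[OF that]
      by (rule eq_matI) (simp_all add: fun_functional.linear_scale[OF T(1)[OF eA]])
    moreover have "dim_col (M x) = m" by (simp add: M_def)
    ultimately show ?thesis by (simp only: det_smult)
  qed
  ultimately have hom: "(\<lambda>x. det (M x)) \<in> homogeneous_poly_funs n"
    by (auto simp: homogeneous_poly_funs_def)
  have "e i = e j \<longleftrightarrow> i = j" if "i < m" "j < m" for i j
    using inj_on_eq_iff[OF bij_betw_imp_inj_on[OF e], of i j] that by simp
  then have "M h = 1\<^sub>m m" unfolding M_def by (intro eq_matI) (auto simp: T(2) eA)
  then have "det (M h) \<noteq> 0" "h \<in> carrier_vec n" by (simp_all add: h_def)
  moreover have "independent_family fun_scale (\<lambda>i. section_point n x (a i) (b i)) A"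
    if det: "det (M x) \<noteq> 0" for x
    unfolding independent_family_def
  proof (intro allI impI)
    fix c assume c: "(\<Sum>i\<in>A. fun_scale (c i) (section_point n x (a i) (b i))) = 0"
    define v where "v = vec m (\<lambda>i. c (e i))"
    \<comment> \<open>A linear relation among the section points, seen through the functionals, is a
      kernel vector of \<open>M x\<close>.\<close>
    have "M x *\<^sub>v v = 0\<^sub>v m"
    proof (rule eq_vecI)
      fix i assume "i < dim_vec (0\<^sub>v m)"
      then have i: "i < m" by simp
      note l = T(1)[OF eA[OF i]]
      have "vec_index (M x *\<^sub>v v) i
        = (\<Sum>j=0..<m. T (e i) (section_point n x (a (e j)) (b (e j))) * c (e j))"
        using i by (auto simp: M_def v_def scalar_prod_def intro!: sum.cong)
      also have "\<dots> = (\<Sum>k\<in>A. T (e i) (section_point n x (a k) (b k)) * c k)"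
        using sum.reindex_bij_betw[OF e, of "\<lambda>k. T (e i) (section_point n x (a k) (b k)) * c k"] .
      also have "\<dots> = T (e i) (\<Sum>k\<in>A. fun_scale (c k) (section_point n x (a k) (b k)))"
        by (simp add: fun_functional.linear_sum[OF l] fun_functional.linear_scale[OF l] mult.commute)
      also have "\<dots> = 0" using c fun_functional.linear_0[OF l] by simp
      finally show "vec_index (M x *\<^sub>v v) i = vec_index (0\<^sub>v m) i" using i by simp
    qed (simp add: M_def)
    moreover have "v \<in> carrier_vec m" "M x \<in> carrier_mat m m" by (simp_all add: v_def M_def)
    moreover have "\<nexists>v. v \<in> carrier_vec m \<and> v \<noteq> 0\<^sub>v m \<and> M x *\<^sub>v v = 0\<^sub>v m"
      using det det_0_iff_vec_prod_zero_field[OF \<open>M x \<in> carrier_mat m m\<close>] by simp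
    ultimately have v0: "v = 0\<^sub>v m" by blast
    have "c (e i) = 0" if "i < m" for i
      using arg_cong[OF v0, of "\<lambda>u. vec_index u i"] that by (simp add: v_def)
    moreover have "A = e ` {0..<m}" using e by (simp add: bij_betw_def)
    ultimately show "\<forall>i\<in>A. c i = 0" by simp
  qed
  ultimately show ?thesis by (intro bexI[OF _ hom]) blast
qed

section \<open>Connected components and edge deletion\<close>

definition edge_steps :: "('v, 'e) multigraph \<Rightarrow> 'e set \<Rightarrow> ('v \<times> 'v) set" where
  "edge_steps G F = {(u, w). \<exists>e\<in>F. ends G e = {#u, w#}}"

lemma reachable_in_eq: "reachable_in G F = (edge_steps G F)\<^sup>* \<inter> verts G \<times> verts G"
  by (simp add: reachable_in_def edge_steps_def)

lemma sym_edge_steps: "sym (edge_steps G F)"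
  by (rule symI) (auto simp: edge_steps_def add_mset_commute)

lemma edge_steps_mono: "F \<subseteq> F' \<Longrightarrow> edge_steps G F \<subseteq> edge_steps G F'"
  by (auto simp: edge_steps_def)

lemma edge_steps_rtrancl_mono: "F \<subseteq> F' \<Longrightarrow> (edge_steps G F)\<^sup>* \<subseteq> (edge_steps G F')\<^sup>*"
  by (intro rtrancl_mono edge_steps_mono)

lemma edge_steps_sym_rtrancl: "(u, w) \<in> (edge_steps G F)\<^sup>* \<Longrightarrow> (w, u) \<in> (edge_steps G F)\<^sup>*"
  using sym_rtrancl[OF sym_edge_steps] by (rule symD)

lemma equiv_reachable_in: "equiv (verts G) (reachable_in G F)"
proof (rule equivI)
  show "reachable_in G F \<subseteq> verts G \<times> verts G" by (auto simp: reachable_in_eq)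
  show "refl_on (verts G) (reachable_in G F)" by (auto simp: reachable_in_eq refl_on_def)
  show "sym (reachable_in G F)"
    using edge_steps_sym_rtrancl by (fastforce simp: reachable_in_eq sym_def)
  show "trans (reachable_in G F)"
    by (rule transI) (auto simp: reachable_in_eq intro: rtrancl_trans)
qed

lemma edge_steps_insert:
  assumes "ends G e = {#u, w#}"
  shows "edge_steps G (insert e F) = insert (u, w) (insert (w, u) (edge_steps G F))"
  using assms by (auto simp: edge_steps_def add_mset_eq_single add_eq_conv_ex)

text \<open>Phrased for adding an edge but used for deleting one: the number of components grows
  exactly when the remaining edges no longer connect its ends, and putting the edge back merges the
  two classes of its ends.\<close>

lemma num_components_insert:
  assumes fin: "finite (verts G)" and e: "ends G e = {#u, w#}" and uw: "u \<in> verts G" "w \<in> verts G"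
  shows "num_components G F
    = num_components G (insert e F) + (if (u, w) \<in> (edge_steps G F)\<^sup>* then 0 else 1)"
proof (cases "(u, w) \<in> (edge_steps G F)\<^sup>*")
  case True
  have "(w, u) \<in> (edge_steps G F)\<^sup>*" using True by (rule edge_steps_sym_rtrancl)
  then have "(edge_steps G (insert e F))\<^sup>* = (edge_steps G F)\<^sup>*"
    using True unfolding edge_steps_insert[OF e] by (intro rtrancl_subset) auto
  then show ?thesis using True by (simp add: num_components_def reachable_in_eq)
next
  case False
  define R where "R = reachable_in G F"
  define R' where "R' = reachable_in G (insert e F)"
  have eq: "equiv (verts G) R" unfolding R_def by (rule equiv_reachable_in)
  define U W where "U = R `` {u}" and "W = R `` {w}"
  \<comment> \<open>A walk through the new edge can be shortened so that it uses the edge once, in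
    one of the two directions.\<close>
  have step: "(x, y) \<in> (edge_steps G (insert e F))\<^sup>* \<longleftrightarrow> (x, y) \<in> (edge_steps G F)\<^sup>*
      \<or> (u, x) \<in> (edge_steps G F)\<^sup>* \<and> (w, y) \<in> (edge_steps G F)\<^sup>*
      \<or> (w, x) \<in> (edge_steps G F)\<^sup>* \<and> (u, y) \<in> (edge_steps G F)\<^sup>*" for x y
    unfolding edge_steps_insert[OF e] rtrancl_insert
    using edge_steps_sym_rtrancl[of _ _ G F] rtrancl_trans[of _ _ "edge_steps G F"] False
    by blast
  have R': "R' = R \<union> (U \<times> W \<union> W \<times> U)"
    using uw unfolding R'_def R_def U_def W_def reachable_in_eq by (auto simp: step)
  have UW: "U \<in> verts G // R" "W \<in> verts G // R"
    using uw by (auto simp: U_def W_def intro: quotientI)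
  have "(u, w) \<notin> R" using False by (simp add: R_def reachable_in_eq)
  then have ne: "U \<noteq> W" unfolding U_def W_def using eq uw by (simp add: eq_equiv_class_iff)
  have cls: "R' `` {x} = (if x \<in> U \<union> W then U \<union> W else R `` {x})" if x: "x \<in> verts G" for x
  proof -
    have "R `` {x} = U" if "x \<in> U" using that eq unfolding U_def by (metis Image_singleton_iff equiv_class_eq)
    moreover have "R `` {x} = W" if "x \<in> W" using that eq unfolding W_def by (metis Image_singleton_iff equiv_class_eq)
    ultimately show ?thesis unfolding R' by auto
  qed
  have mem: "x \<in> R `` {x}" if "x \<in> verts G" for x using eq that by (rule equiv_class_self)
  have q: "verts G // R' = insert (U \<union> W) (verts G // R - {U, W})"
  proof (intro subset_antisym subsetI)
    fix X assume "X \<in> verts G // R'"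
    then obtain x where x: "x \<in> verts G" "X = R' `` {x}" by (auto elim: quotientE)
    show "X \<in> insert (U \<union> W) (verts G // R - {U, W})"
    proof (cases "x \<in> U \<union> W")
      case True
      then show ?thesis using x cls by simp
    next
      case False
      then have "X = R `` {x}" using x cls by simp
      moreover have "X \<noteq> U" "X \<noteq> W" using False mem[OF x(1)] calculation by auto
      ultimately show ?thesis using x(1) by (auto intro: quotientI)
    qed
  next
    fix X assume X: "X \<in> insert (U \<union> W) (verts G // R - {U, W})"
    show "X \<in> verts G // R'"
    proof (cases "X = U \<union> W")
      case True
      have "u \<in> U" unfolding U_def using mem uw by blast
      then have "X = R' `` {u}" using cls[OF uw(1)] True by simp
      then show ?thesis using uw by (auto intro: quotientI)
    next
      case False
      then have X': "X \<in> verts G // R" "X \<noteq> U" "X \<noteq> W" using X by auto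
      then obtain x where x: "x \<in> verts G" "X = R `` {x}" by (auto elim: quotientE)
      have "x \<notin> U" using X'(2) x eq unfolding U_def by (metis Image_singleton_iff equiv_class_eq)
      moreover have "x \<notin> W" using X'(3) x eq unfolding W_def by (metis Image_singleton_iff equiv_class_eq)
      ultimately have "X = R' `` {x}" using cls[OF x(1)] x(2) by simp
      then show ?thesis using x(1) by (auto intro: quotientI)
    qed
  qed
  have finq: "finite (verts G // R)"
    using fin eq by (meson equiv_type finite_quotient)
  have "U \<union> W \<notin> verts G // R - {U, W}"
  proof
    assume "U \<union> W \<in> verts G // R - {U, W}"
    then have "U \<union> W \<in> verts G // R" "U \<union> W \<noteq> U" by auto
    moreover have "u \<in> U \<inter> (U \<union> W)" unfolding U_def using mem uw by blast
    ultimately show False using quotient_disj[OF eq UW(1)] by blast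
  qed
  then have "card (verts G // R') = Suc (card (verts G // R - {U, W}))"
    unfolding q using finq by simp
  moreover have "card (verts G // R - {U, W}) = card (verts G // R) - 2"
    using UW ne finq by (subst card_Diff_subset) auto
  moreover have "card {U, W} \<le> card (verts G // R)" using UW finq by (intro card_mono) auto
  ultimately have "card (verts G // R) = card (verts G // R') + 1" using ne by simp
  then show ?thesis using False by (simp add: num_components_def R_def R'_def)
qed

lemma connected_if_one_component:
  assumes "num_components G F = 1" and uw: "u \<in> verts G" "w \<in> verts G"
  shows "(u, w) \<in> (edge_steps G F)\<^sup>*"
proof -
  obtain X where X: "verts G // reachable_in G F = {X}"
    using card_1_singletonE[OF assms(1)[unfolded num_components_def]] by blast
  have "reachable_in G F `` {u} = X" "reachable_in G F `` {w} = X"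
    using X quotientI[of _ "verts G" "reachable_in G F"] uw by auto
  then have "(u, w) \<in> reachable_in G F"
    using eq_equiv_class_iff[OF equiv_reachable_in[of G F] uw] by simp
  then show ?thesis by (simp add: reachable_in_eq)
qed

lemma bond_rank_connected:
  "num_components G (edges G) = 1 \<Longrightarrow>
    bond_rank G F = int (card F) + 1 - int (num_components G (edges G - F))"
  by (simp add: bond_rank_def cycle_rank_def)

text \<open>Cutting a walk at its first visit to \<open>v\<close> keeps the initial part off all
  edges at \<open>v\<close> and exposes the edge of arrival.\<close>

lemma first_arrival:
  assumes F: "F \<subseteq> edges G" and path: "(x, y) \<in> (edge_steps G F)\<^sup>*" and xv: "x \<noteq> v"
  shows "(x, y) \<in> (edge_steps G (F - incident_edges G {v}))\<^sup>* \<and> y \<noteq> v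
    \<or> (\<exists>e u. e \<in> F \<and> e \<in> incident_edges G {v} \<and> ends G e = {#u, v#}
        \<and> (x, u) \<in> (edge_steps G (F - incident_edges G {v}))\<^sup>*)"
  using path
proof (induction rule: rtrancl_induct)
  case base
  then show ?case using xv by simp
next
  case (step y z)
  show ?case
  proof (cases "(x, y) \<in> (edge_steps G (F - incident_edges G {v}))\<^sup>* \<and> y \<noteq> v")
    case True
    obtain e where e: "e \<in> F" "ends G e = {#y, z#}" using step.hyps by (auto simp: edge_steps_def)
    show ?thesis
    proof (cases "z = v")
      case True
      have "e \<in> incident_edges G {v}" using e F True by (auto simp: incident_edges_def)
      then show ?thesis using e True \<open>_ \<and> _\<close> by blast
    next
      case False
      then have "e \<in> F - incident_edges G {v}" using e True by (auto simp: incident_edges_def)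
      then have "(y, z) \<in> edge_steps G (F - incident_edges G {v})"
        using e(2) by (auto simp: edge_steps_def)
      then show ?thesis using True False by (meson rtrancl.rtrancl_into_rtrancl)
    qed
  next
    case False
    then show ?thesis using step by blast
  qed
qed

text \<open>The source of two independent residue vectors on a component. After removal of
  \<open>e1\<close>, a walk from its other end still reaches \<open>v\<close>, for the first time
  through some \<open>e2\<close>. That walk avoids the third edge \<open>e3\<close>, so
  \<open>e1\<close> is no bridge of the connected graph without \<open>e3\<close>, and
  \<open>e1\<close> and \<open>e3\<close> can go together.\<close>

lemma exists_removable_pair:
  assumes G: "finite_multigraph G" "two_edge_connected G" and v: "v \<in> verts G"
    and deg: "card (incident_edges G {v}) = 3"
    and loopless: "\<And>e. e \<in> edges G \<Longrightarrow> ends G e \<noteq> {#v, v#}"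
  shows "\<exists>e e'. e \<noteq> e' \<and> e \<in> incident_edges G {v} \<and> e' \<in> incident_edges G {v} \<and>
    num_components G (edges G - {e, e'}) = 1"
proof -
  let ?D = "incident_edges G {v}"
  have other: "\<exists>u. ends G e = {#u, v#} \<and> u \<noteq> v \<and> u \<in> verts G" if e: "e \<in> ?D" for e
  proof -
    have "e \<in> edges G" "v \<in># ends G e" using e by (auto simp: incident_edges_def)
    then obtain M where M: "ends G e = add_mset v M" by (meson mset_add)
    moreover have "size (ends G e) = 2" "set_mset (ends G e) \<subseteq> verts G"
      using G(1) \<open>e \<in> edges G\<close> by (auto simp: finite_multigraph_def)
    ultimately have "size M = 1" by simp
    then obtain u where "M = {#u#}" using size_1_singleton_mset by blast
    then have "ends G e = {#u, v#}" using M by (simp add: add_mset_commute)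
    moreover have "u \<noteq> v" using loopless[OF \<open>e \<in> edges G\<close>] calculation by blast
    moreover have "u \<in> verts G" using \<open>set_mset (ends G e) \<subseteq> verts G\<close> calculation(1) by simp
    ultimately show ?thesis by blast
  qed
  have "?D \<noteq> {}" using deg by auto
  then obtain e1 where e1: "e1 \<in> ?D" by blast
  obtain u1 where u1: "ends G e1 = {#u1, v#}" "u1 \<noteq> v" "u1 \<in> verts G" using other[OF e1] by blast
  have one: "num_components G (edges G - {e}) = 1" if "e \<in> ?D" for e
    using G(2) that by (auto simp: two_edge_connected_def incident_edges_def)
  have "(u1, v) \<in> (edge_steps G (edges G - {e1}))\<^sup>*"
    using connected_if_one_component[OF one[OF e1] u1(3) v] .
  from first_arrival[OF Diff_subset this u1(2)] obtain e2 u2 where e2: "e2 \<noteq> e1" "e2 \<in> ?D"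
    "ends G e2 = {#u2, v#}" "(u1, u2) \<in> (edge_steps G (edges G - {e1} - ?D))\<^sup>*" by blast
  have "?D - {e1, e2} \<noteq> {}"
  proof
    assume "?D - {e1, e2} = {}"
    then have "card ?D \<le> card {e1, e2}" by (intro card_mono) auto
    then show False using deg e2(1) by simp
  qed
  then obtain e3 where e3: "e3 \<in> ?D" "e3 \<noteq> e1" "e3 \<noteq> e2" by blast
  have "(u1, u2) \<in> (edge_steps G (edges G - {e1, e3}))\<^sup>*"
  proof -
    have "edges G - {e1} - ?D \<subseteq> edges G - {e1, e3}" using e3 by auto
    from edge_steps_rtrancl_mono[OF this] e2(4) show ?thesis by (rule subsetD)
  qed
  moreover have "(u2, v) \<in> edge_steps G (edges G - {e1, e3})"
  proof -
    have "e2 \<in> edges G - {e1, e3}" using e2 e3(3) unfolding incident_edges_def by blast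
    then show ?thesis using e2(3) unfolding edge_steps_def by blast
  qed
  ultimately have con: "(u1, v) \<in> (edge_steps G (edges G - {e1, e3}))\<^sup>*"
    by (rule rtrancl_into_rtrancl)
  have ins: "insert e1 (edges G - {e1, e3}) = edges G - {e3}"
  proof -
    have "e1 \<in> edges G" using e1 by (simp add: incident_edges_def)
    then show ?thesis using e3(2) by auto
  qed
  have "finite (verts G)" using G(1) by (simp add: finite_multigraph_def)
  from num_components_insert[OF this u1(1) u1(3) v, of "edges G - {e1, e3}"]
  have "num_components G (edges G - {e1, e3}) = 1"
    unfolding ins one[OF e3(1)] using con by (simp only: if_True add_0_right)
  with e1 e3(1) e3(2)[symmetric] show ?thesis by (intro exI conjI)
qed

section \<open>Sections of the dualizing sheaf as flows\<close>

locale canonical_graph_curve =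
  fixes G :: "('v, 'e) multigraph"
    and C :: "('v, 'e, 'k::alg_closed_field) glued_curve"
    and g :: nat
    and s :: "nat \<Rightarrow> 'v \<Rightarrow> 'k poly fract"
  assumes finite_G: "finite_multigraph G"
    and trivalent_G: "trivalent G"
    and two_edge_connected_G: "two_edge_connected G"
    and graph_curve_C: "graph_curve C"
    and dual_C: "has_dual_graph C G"
    and basis: "canonical_basis C g s"
begin

lemma verts_eq: "verts G = comps C" and edges_eq: "edges G = nodes C"
  using dual_C by (auto simp: has_dual_graph_def dual_graph_def)

lemma finite_verts: "finite (verts G)" and finite_edges: "finite (edges G)"
  using finite_G by (auto simp: finite_multigraph_def)

abbreviation pts :: "'v \<Rightarrow> 'k proj_line set" where
  "pts v \<equiv> node_points C v"

abbreviation br :: "'e \<Rightarrow> ('v \<times> 'k proj_line) set" where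
  "br e \<equiv> branches C e"

lemma card_pts: "v \<in> verts G \<Longrightarrow> card (pts v) = 3"
  using graph_curve_C by (simp add: graph_curve_def verts_eq)

lemma finite_pts: "v \<in> verts G \<Longrightarrow> finite (pts v)"
  using card_pts card.infinite by fastforce

lemma branches_cases:
  assumes e: "e \<in> edges G"
  obtains u x w y where "br e = {(u, x), (w, y)}" "u \<noteq> w" "u \<in> verts G" "w \<in> verts G"
    "x \<in> pts u" "y \<in> pts w" "ends G e = {#u, w#}"
proof -
  have e': "e \<in> nodes C" using e edges_eq by simp
  have c: "card (br e) = 2" "card (fst ` br e) = 2" "fst ` br e \<subseteq> comps C"
    using graph_curve_C e' unfolding graph_curve_def by blast+
  obtain p q where pq: "br e = {p, q}" "p \<noteq> q" using c(1) by (auto simp: card_2_iff)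
  obtain u x where p: "p = (u, x)" by (cases p)
  obtain w y where q: "q = (w, y)" by (cases q)
  have ne: "u \<noteq> w" using c(2) pq p q by auto
  have "ends G e = image_mset fst (mset_set (br e))"
    using dual_C e by (simp add: has_dual_graph_def dual_graph_def)
  then have "ends G e = {#u, w#}" using pq p q by simp
  moreover have "x \<in> pts u" "y \<in> pts w"
    unfolding node_points_def using e' pq(1) p q by blast+
  ultimately show ?thesis using that[of u x w y] pq(1) p q ne c(3) verts_eq by simp
qed

text \<open>The oriented form: the branches come in the order of the given ends, as is needed to
  follow a step of a walk.\<close>

lemma branches_cases_ends:
  assumes e: "e \<in> edges G" and ends: "ends G e = {#u, w#}"
  obtains x y where "br e = {(u, x), (w, y)}" "u \<noteq> w" "u \<in> verts G" "w \<in> verts G"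
    "x \<in> pts u" "y \<in> pts w"
proof -
  obtain u' x w' y where b: "br e = {(u', x), (w', y)}" "u' \<noteq> w'" "u' \<in> verts G" "w' \<in> verts G"
    "x \<in> pts u'" "y \<in> pts w'" "ends G e = {#u', w'#}"
    using branches_cases[OF e] .
  from b(7) ends have "u = u' \<and> w = w' \<or> u = w' \<and> w = u'"
    by (auto simp: add_mset_eq_single add_eq_conv_ex)
  then show ?thesis
  proof (elim disjE conjE)
    assume "u = u'" "w = w'"
    then show ?thesis using b that[of x y] by simp
  next
    assume "u = w'" "w = u'"
    then show ?thesis using b that[of y x] by (simp add: insert_commute)
  qed
qed

lemma branches_disjoint:
  assumes "e \<in> edges G" "e' \<in> edges G" "e \<noteq> e'"
  shows "br e \<inter> br e' = {}"
  using graph_curve_C assms unfolding graph_curve_def edges_eq by blast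

lemma finite_branches: "e \<in> edges G \<Longrightarrow> finite (br e)"
  by (erule branches_cases) simp

lemma branch_in_pts: "e \<in> edges G \<Longrightarrow> (v, x) \<in> br e \<Longrightarrow> v \<in> verts G \<and> x \<in> pts v"
  by (erule branches_cases) auto

lemma pts_branch: "x \<in> pts v \<Longrightarrow> \<exists>e\<in>edges G. (v, x) \<in> br e"
  by (auto simp: node_points_def edges_eq)

lemma ends_branches: "e \<in> edges G \<Longrightarrow> set_mset (ends G e) = fst ` br e"
  by (erule branches_cases) simp

lemma exists_section_forms:
  "\<exists>\<alpha> \<beta>. \<forall>j<g. \<forall>v\<in>verts G. s j v = Fract [:\<alpha> v j, \<beta> v j:] (pole_poly (pts v))"
proof -
  have "\<exists>\<alpha> \<beta>. s j v = Fract [:\<alpha>, \<beta>:] (pole_poly (pts v))" if "j < g" "v \<in> verts G" for j v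
  proof (rule regular_differential_form[OF card_pts[OF that(2)]])
    have "s j \<in> dualizing_sections C" using basis that(1) by (simp add: canonical_basis_def)
    then show "fls_subdegree (diff_expansion x (s j v)) \<ge> (if x \<in> pts v then - 1 else 0)" for x
      using that(2) unfolding dualizing_sections_def verts_eq by blast
  qed
  then have "\<exists>P. j < g \<longrightarrow> v \<in> verts G \<longrightarrow> s j v = Fract [:fst P, snd P:] (pole_poly (pts v))" for j v
    by (metis fst_conv snd_conv)
  then obtain P where "\<And>j v. j < g \<Longrightarrow> v \<in> verts G \<Longrightarrow>
      s j v = Fract [:fst (P j v), snd (P j v):] (pole_poly (pts v))"
    by metis
  then show ?thesis
    by (intro exI[of _ "\<lambda>v j. fst (P j v)"] exI[of _ "\<lambda>v j. snd (P j v)"]) simp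
qed

text \<open>Both families of coefficients are chosen as one pair, so that \<open>av\<close> and
  \<open>bv\<close> belong to the same numerators.\<close>

definition forms :: "('v \<Rightarrow> nat \<Rightarrow> 'k) \<times> ('v \<Rightarrow> nat \<Rightarrow> 'k)" where
  "forms = (SOME (\<alpha>, \<beta>). \<forall>j<g. \<forall>v\<in>verts G. s j v = Fract [:\<alpha> v j, \<beta> v j:] (pole_poly (pts v)))"

text \<open>In coordinates dual to the basis \<open>s\<close>, the vectors \<open>av v\<close> and
  \<open>bv v\<close> span the image line of the component \<open>v\<close>: over all
  \<open>j\<close> they collect the constant and the linear coefficients of the numerators of
  \<open>s j\<close> on \<open>v\<close>. The default 0 from \<open>g\<close> on makes them
  coordinate vectors of length \<open>g\<close>.\<close>

definition av :: "'v \<Rightarrow> nat \<Rightarrow> 'k" where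
  "av v = (\<lambda>j. if j < g then fst forms v j else 0)"

definition bv :: "'v \<Rightarrow> nat \<Rightarrow> 'k" where
  "bv v = (\<lambda>j. if j < g then snd forms v j else 0)"

lemma section_form:
  assumes "j < g" "v \<in> verts G"
  shows "s j v = Fract [:av v j, bv v j:] (pole_poly (pts v))"
proof -
  have "case forms of (\<alpha>, \<beta>) \<Rightarrow>
      \<forall>j<g. \<forall>v\<in>verts G. s j v = Fract [:\<alpha> v j, \<beta> v j:] (pole_poly (pts v))"
    unfolding forms_def by (rule someI_ex) (use exists_section_forms in auto)
  then show ?thesis using assms by (simp add: av_def bv_def case_prod_beta)
qed

lemma av_bv_supported: "g \<le> j \<Longrightarrow> av v j = 0 \<and> bv v j = 0"
  by (simp add: av_def bv_def)

text \<open>Homogeneous coordinates of the image of the point \<open>x\<close> of component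
  \<open>v\<close>, up to \<open>value_factor\<close>.\<close>

definition line_vec :: "'v \<Rightarrow> 'k proj_line \<Rightarrow> nat \<Rightarrow> 'k" where
  "line_vec v x = (\<lambda>j. line_form (av v j) (bv v j) x)"

text \<open>For a branch \<open>p\<close> of a node, this is the functional taking a section to its
  residue at \<open>p\<close>, written in the basis \<open>s\<close>.\<close>

definition res_vec :: "'v \<times> 'k proj_line \<Rightarrow> nat \<Rightarrow> 'k" where
  "res_vec p = fun_scale (value_factor (pts (fst p)) (snd p)) (line_vec (fst p) (snd p))"

lemma res_vec_residue:
  assumes "j < g" "v \<in> verts G" "x \<in> pts v"
  shows "diff_residue x (s j v) = res_vec (v, x) j"
  using has_leadD[OF has_lead_diff_expansion[OF card_pts[OF assms(2)], of x "av v j" "bv v j"]] assms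
  by (simp add: section_form diff_residue_def res_vec_def fun_scale_def line_vec_def)

lemma line_vec_supported: "g \<le> j \<Longrightarrow> line_vec v x j = 0"
  by (simp add: line_vec_def line_form_def av_bv_supported split: proj_line.split)

lemma res_vec_supported: "g \<le> j \<Longrightarrow> res_vec p j = 0"
  by (simp add: res_vec_def fun_scale_def line_vec_supported)

lemma sum_fun_apply: "(\<Sum>p\<in>X. f p) j = (\<Sum>p\<in>X. f p j)"
  for f :: "'i \<Rightarrow> nat \<Rightarrow> 'k"
  by (induction X rule: infinite_finite_induct) auto

lemma sum_res_vec_branches:
  assumes e: "e \<in> edges G"
  shows "(\<Sum>p\<in>br e. res_vec p) = 0"
proof
  fix j
  show "(\<Sum>p\<in>br e. res_vec p) j = 0 j"
  proof (cases "j < g")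
    case True
    then have "s j \<in> dualizing_sections C" using basis by (simp add: canonical_basis_def)
    then have "(\<Sum>(v, x)\<in>br e. diff_residue x (s j v)) = 0"
      using e unfolding dualizing_sections_def edges_eq by blast
    moreover have "(\<Sum>(v, x)\<in>br e. diff_residue x (s j v)) = (\<Sum>p\<in>br e. res_vec p j)"
    proof (rule sum.cong[OF refl])
      fix p assume "p \<in> br e"
      then show "(case p of (v, x) \<Rightarrow> diff_residue x (s j v)) = res_vec p j"
        using branch_in_pts[OF e] True by (cases p) (simp add: res_vec_residue)
    qed
    ultimately show ?thesis by (simp add: sum_fun_apply)
  qed (simp add: sum_fun_apply res_vec_supported)
qed

lemma sum_res_vec_pts:
  assumes v: "v \<in> verts G"
  shows "(\<Sum>x\<in>pts v. res_vec (v, x)) = 0"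
  using residue_theorem[OF card_pts[OF v]]
  by (auto simp: fun_eq_iff sum_fun_apply res_vec_def fun_scale_def line_vec_def)

text \<open>The cycle space of \<open>G\<close> over the field, with a value for each half-edge in
  place of an orientation of the edges.\<close>

definition flow :: "('v \<times> 'k proj_line \<Rightarrow> 'k) \<Rightarrow> bool" where
  "flow \<phi> \<longleftrightarrow> (\<forall>e\<in>edges G. (\<Sum>p\<in>br e. \<phi> p) = 0) \<and> (\<forall>v\<in>verts G. (\<Sum>x\<in>pts v. \<phi> (v, x)) = 0)"

lemma Fract_sum:
  fixes n :: nat
  assumes "Q \<noteq> (0 :: 'k poly)"
  shows "(\<Sum>j<n. Fract [:c j:] 1 * Fract [:\<alpha> j, \<beta> j:] Q)
    = Fract [:\<Sum>j<n. c j * \<alpha> j, \<Sum>j<n. c j * \<beta> j:] Q"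
proof (induction n)
  case 0
  then show ?case using assms by (simp add: Zero_fract_def eq_fract)
next
  case (Suc n)
  have "Fract [:x, y:] Q + Fract [:z, w:] Q = Fract [:x + z, y + w:] Q" for x y z w
    using assms by (simp add: eq_fract) (simp add: algebra_simps smult_add_left)
  moreover have "Fract [:c n:] 1 * Fract [:\<alpha> n, \<beta> n:] Q = Fract [:c n * \<alpha> n, c n * \<beta> n:] Q"
    by (simp add: mult.commute)
  ultimately show ?case using Suc by (simp only: sum.lessThan_Suc)
qed

text \<open>Here the basis must span: the prescribed residues are realised on each component
  separately, the result is a section, and its coefficients \<open>c\<close> form a linear
  functional taking each \<open>res_vec (v, x)\<close> to the value of the flow. Flows can therefore
  separate residue vectors.\<close>

lemma flow_is_combination:
  assumes \<phi>: "flow \<phi>"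
  shows "\<exists>c. \<forall>v\<in>verts G. \<forall>x\<in>pts v. \<phi> (v, x) = (\<Sum>j<g. c j * res_vec (v, x) j)"
proof -
  have "\<exists>P Q. \<forall>x\<in>pts v. value_factor (pts v) x * line_form P Q x = \<phi> (v, x)" if "v \<in> verts G" for v
    using exists_form_with_residues[OF card_pts[OF that], of "\<lambda>x. \<phi> (v, x)"] \<phi> that
    by (simp add: flow_def)
  then obtain P Q where PQ: "\<And>v x. v \<in> verts G \<Longrightarrow> x \<in> pts v \<Longrightarrow>
      value_factor (pts v) x * line_form (P v) (Q v) x = \<phi> (v, x)"
    by metis
  define \<eta> where "\<eta> = (\<lambda>v. if v \<in> verts G then Fract [:P v, Q v:] (pole_poly (pts v)) else 0)"
  have lead: "has_lead (diff_expansion x (\<eta> v)) (if x \<in> pts v then - 1 else 0)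
      (value_factor (pts v) x * line_form (P v) (Q v) x)" if "v \<in> verts G" for v x
    using has_lead_diff_expansion[OF card_pts[OF that]] that by (simp add: \<eta>_def)
  have res: "diff_residue x (\<eta> v) = \<phi> (v, x)" if "v \<in> verts G" "x \<in> pts v" for v x
    using has_leadD[OF lead[OF that(1), of x]] that PQ by (simp add: diff_residue_def)
  have \<eta>: "\<eta> \<in> dualizing_sections C"
    unfolding dualizing_sections_def verts_eq[symmetric] edges_eq[symmetric]
  proof (intro CollectI conjI allI impI ballI)
    fix v assume "v \<notin> verts G"
    then show "\<eta> v = 0" by (simp add: \<eta>_def)
  next
    fix v x assume v: "v \<in> verts G"
    show "(if x \<in> pts v then - 1 else 0) \<le> fls_subdegree (diff_expansion x (\<eta> v))"
      using has_lead_le_subdegree[OF lead[OF v, of x]]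
      by (cases "diff_expansion x (\<eta> v) = 0") simp_all
  next
    fix e assume e: "e \<in> edges G"
    have "(\<Sum>(v, x)\<in>br e. diff_residue x (\<eta> v)) = (\<Sum>p\<in>br e. \<phi> p)"
    proof (rule sum.cong[OF refl])
      fix p assume "p \<in> br e"
      then show "(case p of (v, x) \<Rightarrow> diff_residue x (\<eta> v)) = \<phi> p"
        using branch_in_pts[OF e] by (cases p) (simp add: res)
    qed
    then show "(\<Sum>(v, x)\<in>br e. diff_residue x (\<eta> v)) = 0" using \<phi> e by (simp add: flow_def)
  qed
  have "\<forall>\<eta>\<in>dualizing_sections C. \<exists>!c. c \<in> carrier_vec g \<and>
      (\<forall>v. \<eta> v = (\<Sum>j<g. Fract [:vec_index c j:] 1 * s j v))"
    using basis unfolding canonical_basis_def by (rule conjunct2)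
  from ex1_implies_ex[OF bspec[OF this \<eta>]]
  obtain c where c: "\<And>v. \<eta> v = (\<Sum>j<g. Fract [:vec_index c j:] 1 * s j v)"
    by (elim exE conjE) (rule that, erule spec)
  have "\<phi> (v, x) = (\<Sum>j<g. vec_index c j * res_vec (v, x) j)" if v: "v \<in> verts G" and x: "x \<in> pts v" for v x
  proof -
    have pp: "pole_poly (pts v) \<noteq> 0" using finite_pts[OF v] by simp
    have "\<eta> v = (\<Sum>j<g. Fract [:vec_index c j:] 1 * Fract [:av v j, bv v j:] (pole_poly (pts v)))"
      unfolding c by (rule sum.cong[OF refl]) (simp add: section_form[OF _ v])
    then have "Fract [:P v, Q v:] (pole_poly (pts v)) = Fract [:\<Sum>j<g. vec_index c j * av v j,
        \<Sum>j<g. vec_index c j * bv v j:] (pole_poly (pts v))"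
      using v unfolding Fract_sum[OF pp] by (simp add: \<eta>_def)
    note iffD1[OF eq_fract(1)[OF pp pp] this]
    then have "[:P v, Q v:] = [:\<Sum>j<g. vec_index c j * av v j, \<Sum>j<g. vec_index c j * bv v j:]"
      using pp by (simp only: mult_cancel_right) simp
    then have P: "P v = (\<Sum>j<g. vec_index c j * av v j)" and Q: "Q v = (\<Sum>j<g. vec_index c j * bv v j)"
      by simp_all
    have "line_form (P v) (Q v) x = (\<Sum>j<g. vec_index c j * line_vec v x j)"
    proof (cases x)
      case (Aff a)
      have "(\<Sum>j<g. vec_index c j * (av v j + a * bv v j))
        = (\<Sum>j<g. vec_index c j * av v j + a * (vec_index c j * bv v j))"
        by (rule sum.cong[OF refl]) (simp only: distrib_left mult.left_commute)
      also have "\<dots> = P v + a * Q v" by (simp only: sum.distrib sum_distrib_left P Q)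
      finally show ?thesis using Aff by (simp add: line_vec_def line_form_def)
    qed (simp add: P Q line_vec_def line_form_def)
    then have "\<phi> (v, x) = value_factor (pts v) x * (\<Sum>j<g. vec_index c j * line_vec v x j)"
      using PQ[OF v x] by simp
    also have "\<dots> = (\<Sum>j<g. vec_index c j * (value_factor (pts v) x * line_vec v x j))"
      by (simp only: sum_distrib_left mult.left_commute)
    finally show ?thesis by (simp only: res_vec_def fun_scale_def fst_conv snd_conv)
  qed
  then show ?thesis by (intro exI[of _ "vec_index c"]) blast
qed

end

section \<open>Chains and flows supported on walks\<close>

context canonical_graph_curve
begin

text \<open>The unit chain on an edge with branches \<open>p\<close> and \<open>q\<close>;
  \<open>sum_pts_pulse\<close> computes its boundary.\<close>

definition pulse :: "'v \<times> 'k proj_line \<Rightarrow> 'v \<times> 'k proj_line \<Rightarrow> 'v \<times> 'k proj_line \<Rightarrow> 'k" where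
  "pulse p q r = of_bool (r = p) - of_bool (r = q)"

lemma sum_pts_of_bool:
  assumes "v \<in> verts G" "x \<in> pts u"
  shows "(\<Sum>y\<in>pts v. of_bool ((v, y) = (u, x)) :: 'k) = of_bool (v = u)"
proof (cases "v = u")
  case True
  have "(\<Sum>y\<in>pts v. of_bool ((v, y) = (u, x)) :: 'k) = (\<Sum>y\<in>{x}. 1)"
    using assms finite_pts[OF assms(1)] True by (intro sum.mono_neutral_cong_right) auto
  then show ?thesis using True by simp
qed simp

lemma sum_pts_pulse:
  assumes "v \<in> verts G" "x \<in> pts u" "y \<in> pts w"
  shows "(\<Sum>z\<in>pts v. pulse (u, x) (w, y) (v, z)) = of_bool (v = u) - of_bool (v = w)"
  unfolding pulse_def sum_subtractf
  by (simp only: sum_pts_of_bool[OF assms(1,2)] sum_pts_of_bool[OF assms(1,3)])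

lemma pulse_other_branch:
  assumes "e \<in> edges G" "br e = {p, q}" "e' \<in> edges G" "e' \<noteq> e" "r \<in> br e'"
  shows "pulse p q r = 0"
proof -
  have "r \<noteq> p" "r \<noteq> q" using branches_disjoint[OF assms(3,1,4)] assms(2,5) by auto
  then show ?thesis by (simp add: pulse_def)
qed

lemma sum_branches_pulse:
  assumes "e \<in> edges G" "br e = {p, q}" "p \<noteq> q" "e' \<in> edges G"
  shows "(\<Sum>r\<in>br e'. pulse p q r) = 0"
proof (cases "e' = e")
  case True
  then show ?thesis using assms(2,3) by (simp add: pulse_def)
next
  case False
  then show ?thesis using pulse_other_branch[OF assms(1,2,4)] by simp
qed

text \<open>The unit chains of the edges of a walk add up, and their boundaries telescope.\<close>

lemma path_flow:
  assumes F: "F \<subseteq> edges G" and path: "(u, w) \<in> (edge_steps G F)\<^sup>*"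
  shows "\<exists>\<phi>. (\<forall>e\<in>edges G. (\<Sum>p\<in>br e. \<phi> p) = 0) \<and> (\<forall>e\<in>edges G - F. \<forall>p\<in>br e. \<phi> p = 0)
    \<and> (\<forall>v\<in>verts G. (\<Sum>x\<in>pts v. \<phi> (v, x)) = of_bool (v = u) - (of_bool (v = w) :: 'k))"
  using path
proof (induction rule: rtrancl_induct)
  case base
  show ?case by (rule exI[of _ "\<lambda>_. 0"]) simp
next
  case (step y z)
  from step.IH obtain \<phi> where "\<forall>e\<in>edges G. (\<Sum>p\<in>br e. \<phi> p) = 0"
    "\<forall>e\<in>edges G - F. \<forall>p\<in>br e. \<phi> p = 0"
    "\<forall>v\<in>verts G. (\<Sum>x\<in>pts v. \<phi> (v, x)) = of_bool (v = u) - (of_bool (v = y) :: 'k)"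
    by (elim exE conjE) (rule that; assumption)
  note \<phi> = this[rule_format]
  obtain e where e: "e \<in> F" "ends G e = {#y, z#}" using step.hyps(2) by (auto simp: edge_steps_def)
  have eG: "e \<in> edges G" using e(1) F by blast
  obtain x x' where b: "br e = {(y, x), (z, x')}" "y \<noteq> z" "x \<in> pts y" "x' \<in> pts z"
    using branches_cases_ends[OF eG e(2)] by metis
  have ne: "(y, x) \<noteq> (z, x')" using b(2) by simp
  let ?\<psi> = "\<lambda>p. \<phi> p + pulse (y, x) (z, x') p"
  show ?case
  proof (intro exI[of _ ?\<psi>] conjI ballI)
    fix e' assume e': "e' \<in> edges G"
    show "(\<Sum>p\<in>br e'. ?\<psi> p) = 0"
      using \<phi>(1)[OF e'] sum_branches_pulse[OF eG b(1) ne e'] by (simp add: sum.distrib)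
  next
    fix e' p assume e': "e' \<in> edges G - F" and p: "p \<in> br e'"
    have "e' \<in> edges G" "e' \<noteq> e" using e' e(1) by auto
    then show "?\<psi> p = 0" using \<phi>(2)[OF e' p] pulse_other_branch[OF eG b(1) _ _ p] by simp
  next
    fix v assume v: "v \<in> verts G"
    show "(\<Sum>x\<in>pts v. ?\<psi> (v, x)) = of_bool (v = u) - of_bool (v = z)"
      using \<phi>(3)[OF v] sum_pts_pulse[OF v b(3,4)] by (simp add: sum.distrib)
  qed
qed

section \<open>The span of the residue functionals\<close>

definition res_vecs :: "'e set \<Rightarrow> (nat \<Rightarrow> 'k) set" where
  "res_vecs F = res_vec ` (\<Union>e\<in>F. br e)"

lemma finite_res_vecs: "F \<subseteq> edges G \<Longrightarrow> finite (res_vecs F)"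
  unfolding res_vecs_def using finite_edges finite_branches
  by (intro finite_imageI finite_UN_I) (auto intro: finite_subset)

lemma linear_combination:
  "Vector_Spaces.linear fun_scale (*) (\<lambda>f :: nat \<Rightarrow> 'k. \<Sum>j<g. c j * f j)"
  unfolding Vector_Spaces.linear_iff
proof (intro conjI allI)
  fix f f' :: "nat \<Rightarrow> 'k" and r
  show "(\<Sum>j<g. c j * (f + f') j) = (\<Sum>j<g. c j * f j) + (\<Sum>j<g. c j * f' j)"
    by (simp only: plus_fun_apply distrib_left sum.distrib)
  show "(\<Sum>j<g. c j * fun_scale r f j) = r * (\<Sum>j<g. c j * f j)"
    by (simp only: fun_scale_def sum_distrib_left mult.left_commute)
qed (rule fun_space.vector_space_axioms fun_functional.vs2.vector_space_axioms)+

text \<open>A walk from \<open>u\<close> to \<open>w\<close> avoiding \<open>F\<close> and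
  \<open>e\<close> closes up with \<open>e\<close> to a cycle. Its flow gives a linear functional
  that vanishes on the residue vectors of \<open>F\<close> but not on that of
  \<open>e\<close>.\<close>

lemma res_vec_notin_span:
  assumes F: "F \<subseteq> edges G" and e: "e \<in> edges G" "e \<notin> F"
    and b: "br e = {(u, x), (w, y)}" "u \<noteq> w" "x \<in> pts u" "y \<in> pts w"
    and u: "u \<in> verts G"
    and path: "(u, w) \<in> (edge_steps G (edges G - F - {e}))\<^sup>*"
  shows "res_vec (u, x) \<notin> fun_space.span (res_vecs F)"
proof
  assume span: "res_vec (u, x) \<in> fun_space.span (res_vecs F)"
  have sub: "edges G - F - {e} \<subseteq> edges G" by blast
  from path_flow[OF sub path] obtain \<phi> where "\<forall>e\<in>edges G. (\<Sum>p\<in>br e. \<phi> p) = 0"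
    "\<forall>e'\<in>edges G - (edges G - F - {e}). \<forall>p\<in>br e'. \<phi> p = 0"
    "\<forall>v\<in>verts G. (\<Sum>x\<in>pts v. \<phi> (v, x)) = of_bool (v = u) - (of_bool (v = w) :: 'k)"
    by (elim exE conjE) (rule that; assumption)
  note \<phi> = this[rule_format]
  \<comment> \<open>Both chains have boundary \<open>u - w\<close>, so their difference is conserved
    at every vertex.\<close>
  define \<psi> where "\<psi> = (\<lambda>p. \<phi> p - pulse (u, x) (w, y) p)"
  have ne: "(u, x) \<noteq> (w, y)" using b(2) by simp
  have "flow \<psi>"
    unfolding flow_def \<psi>_def
  proof (intro conjI ballI)
    fix e' assume e': "e' \<in> edges G"
    show "(\<Sum>p\<in>br e'. \<phi> p - pulse (u, x) (w, y) p) = 0"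
      using \<phi>(1)[OF e'] sum_branches_pulse[OF e(1) b(1) ne e'] by (simp add: sum_subtractf)
  next
    fix v assume v: "v \<in> verts G"
    show "(\<Sum>z\<in>pts v. \<phi> (v, z) - pulse (u, x) (w, y) (v, z)) = 0"
      using \<phi>(3)[OF v] sum_pts_pulse[OF v b(3,4)] by (simp add: sum_subtractf)
  qed
  from flow_is_combination[OF this] obtain c where
    c: "\<And>v x. v \<in> verts G \<Longrightarrow> x \<in> pts v \<Longrightarrow> \<psi> (v, x) = (\<Sum>j<g. c j * res_vec (v, x) j)" by blast
  let ?h = "\<lambda>f. \<Sum>j<g. c j * f j"
  have "?h f = 0" if f: "f \<in> res_vecs F" for f
  proof -
    obtain e' p where e': "e' \<in> F" and p: "p \<in> br e'" "f = res_vec p"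
      using f unfolding res_vecs_def by blast
    have e'': "e' \<in> edges G - (edges G - F - {e})" "e' \<in> edges G" "e' \<noteq> e" using e' e F by auto
    have "\<psi> p = 0"
      unfolding \<psi>_def using \<phi>(2)[OF e''(1) p(1)] pulse_other_branch[OF e(1) b(1) e''(2,3) p(1)] by simp
    then show ?thesis using c[of "fst p" "snd p"] branch_in_pts[OF e''(2), of "fst p" "snd p"] p by simp
  qed
  then have "?h (res_vec (u, x)) = 0"
    using fun_functional.linear_eq_0_on_span[OF linear_combination _ span] by blast
  moreover have "e \<in> edges G - (edges G - F - {e})" "(u, x) \<in> br e" using e b(1) by auto
  then have "\<phi> (u, x) = 0" by (rule \<phi>(2))
  then have "\<psi> (u, x) = - 1" using ne by (simp add: \<psi>_def pulse_def)
  ultimately show False using c[OF u b(3)] by simp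
qed

text \<open>The residue theorems of all components on the \<open>u\<close> side of the cut are added
  up. Edges within that side cancel, edges across the cut lie in \<open>F\<close> or equal
  \<open>e\<close>, and \<open>e\<close> contributes only its branch on \<open>u\<close>.\<close>

lemma res_vec_in_span:
  assumes F: "F \<subseteq> edges G" and e: "e \<in> edges G" "e \<notin> F"
    and b: "br e = {(u, x), (w, y)}" "u \<noteq> w" "u \<in> verts G"
    and cut: "(u, w) \<notin> (edge_steps G (edges G - F - {e}))\<^sup>*"
  shows "res_vec (u, x) \<in> fun_space.span (res_vecs F)"
proof -
  define S where "S = {v \<in> verts G. (u, v) \<in> (edge_steps G (edges G - F - {e}))\<^sup>*}"
  have finS: "finite S" using finite_verts by (simp add: S_def)
  define B where "B = (\<lambda>e'. {p \<in> br e'. fst p \<in> S})"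
  have finB: "finite (B e')" if "e' \<in> edges G" for e'
    using finite_branches[OF that] by (simp add: B_def)
  \<comment> \<open>The half-edges at vertices of \<open>S\<close> are regrouped by the edge to
    which they belong.\<close>
  have "Sigma S pts = (\<Union>e'\<in>edges G. B e')"
  proof (intro subset_antisym subsetI)
    fix p assume "p \<in> Sigma S pts"
    then show "p \<in> (\<Union>e'\<in>edges G. B e')"
      using pts_branch by (fastforce simp: B_def)
  next
    fix p assume "p \<in> (\<Union>e'\<in>edges G. B e')"
    then show "p \<in> Sigma S pts"
      using branch_in_pts by (cases p) (auto simp: B_def)
  qed
  then have "(\<Sum>p\<in>Sigma S pts. res_vec p) = (\<Sum>e'\<in>edges G. \<Sum>p\<in>B e'. res_vec p)"
    using finite_edges finB branches_disjoint
    by (simp only:) (intro sum.UNION_disjoint; fastforce simp: B_def)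
  moreover have "(\<Sum>p\<in>Sigma S pts. res_vec p) = (\<Sum>v\<in>S. \<Sum>x\<in>pts v. res_vec (v, x))"
    using finS finite_pts by (subst sum.Sigma) (auto simp: S_def)
  moreover have "\<dots> = 0" using sum_res_vec_pts by (simp add: S_def)
  ultimately have total: "(\<Sum>e'\<in>edges G. \<Sum>p\<in>B e'. res_vec p) = 0" by simp
  have inside: "(\<Sum>p\<in>B e'. res_vec p) \<in> fun_space.span (res_vecs F)"
    if e': "e' \<in> edges G - {e}" for e'
  proof (cases "e' \<in> F")
    case True
    have "res_vec p \<in> fun_space.span (res_vecs F)" if "p \<in> B e'" for p
      using that True by (intro fun_space.span_base) (auto simp: res_vecs_def B_def)
    then show ?thesis by (rule fun_space.span_sum)
  next
    case False
    then have e'': "e' \<in> edges G - F - {e}" "e' \<in> edges G" using e' by auto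
    obtain v z v' z' where b': "br e' = {(v, z), (v', z')}" "v \<in> verts G" "v' \<in> verts G"
      "ends G e' = {#v, v'#}" using branches_cases[OF e''(2)] by metis
    have "(v, v') \<in> edge_steps G (edges G - F - {e})" "(v', v) \<in> edge_steps G (edges G - F - {e})"
      using e''(1) b'(4) by (auto simp: edge_steps_def add_mset_commute)
    then have "v \<in> S \<longleftrightarrow> v' \<in> S"
      using b'(2,3) unfolding S_def by (blast intro: rtrancl_into_rtrancl)
    then have "B e' = br e' \<or> B e' = {}" using b'(1) by (auto simp: B_def)
    then show ?thesis using sum_res_vec_branches[OF e''(2)] fun_space.span_zero by auto
  qed
  have "u \<in> S" "w \<notin> S" using b(3) cut by (auto simp: S_def)
  then have "B e = {(u, x)}" using b(1) by (auto simp: B_def)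
  then have "(\<Sum>e'\<in>edges G. \<Sum>p\<in>B e'. res_vec p)
      = res_vec (u, x) + (\<Sum>e'\<in>edges G - {e}. \<Sum>p\<in>B e'. res_vec p)"
    using e(1) finite_edges by (simp add: sum.remove)
  then have "res_vec (u, x) = - (\<Sum>e'\<in>edges G - {e}. \<Sum>p\<in>B e'. res_vec p)"
    using total by (simp add: eq_neg_iff_add_eq_0)
  moreover have "(\<Sum>e'\<in>edges G - {e}. \<Sum>p\<in>B e'. res_vec p) \<in> fun_space.span (res_vecs F)"
    by (rule fun_space.span_sum) (rule inside)
  ultimately show ?thesis by (simp only: fun_space.span_neg)
qed

lemma num_components_edges: "num_components G (edges G) = 1"
  using two_edge_connected_G[unfolded two_edge_connected_def, rule_format, of "{}"] by simp

text \<open>Moving an edge into \<open>F\<close> raises the dimension if its ends stay connected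
  without it, and the number of components otherwise. Either way both sides grow by one; the
  additive form avoids truncated subtraction.\<close>

lemma dim_res_vecs:
  assumes "F \<subseteq> edges G"
  shows "fun_space.dim (res_vecs F) + num_components G (edges G - F) = card F + 1"
  using finite_subset[OF assms finite_edges] assms
proof (induction F rule: finite_induct)
  case empty
  have "fun_space.dim (res_vecs {}) = 0"
    using fun_space.dim_le_card[of "res_vecs {}" "{}"] by (simp add: res_vecs_def)
  then show ?case using num_components_edges by simp
next
  case (insert e F)
  have e: "e \<in> edges G" and F: "F \<subseteq> edges G" using insert.prems by auto
  obtain u x w y where b: "br e = {(u, x), (w, y)}" "u \<noteq> w" "u \<in> verts G" "w \<in> verts G"
    "x \<in> pts u" "y \<in> pts w" "ends G e = {#u, w#}"
    using branches_cases[OF e] .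
  have "res_vec (u, x) + res_vec (w, y) = 0"
    using sum_res_vec_branches[OF e] b(1,2) by simp
  then have neg: "res_vec (w, y) = - res_vec (u, x)" by (simp add: eq_neg_iff_add_eq_0 add.commute)
  \<comment> \<open>The two branches of \<open>e\<close> carry opposite vectors, so the edge counts
    as a single vector.\<close>
  have "res_vecs (insert e F) = insert (- res_vec (u, x)) (insert (res_vec (u, x)) (res_vecs F))"
    using b(1) neg by (simp add: res_vecs_def insert_commute)
  moreover have "- res_vec (u, x) \<in> fun_space.span (insert (res_vec (u, x)) (res_vecs F))"
    by (intro fun_space.span_neg fun_space.span_base) simp
  ultimately have insert_eq: "fun_space.dim (res_vecs (insert e F))
      = fun_space.dim (insert (res_vec (u, x)) (res_vecs F))"
    using finite_res_vecs[OF F] by (simp add: fun_space.dim_insert_finite)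
  have diff: "edges G - F - {e} = edges G - insert e F" by auto
  have "fun_space.dim (insert (res_vec (u, x)) (res_vecs F)) = fun_space.dim (res_vecs F)
      + (if (u, w) \<in> (edge_steps G (edges G - insert e F))\<^sup>* then 1 else 0)"
    using res_vec_notin_span[OF F e insert.hyps(2) b(1,2,5,6,3), unfolded diff]
      res_vec_in_span[OF F e insert.hyps(2) b(1,2,3), unfolded diff]
    by (simp add: fun_space.dim_insert_finite[OF finite_res_vecs[OF F]])
  note insert_eq[unfolded this]
  moreover have "insert e (edges G - insert e F) = edges G - F" using e insert.hyps(2) by auto
  then have "num_components G (edges G - insert e F) = num_components G (edges G - F)
      + (if (u, w) \<in> (edge_steps G (edges G - insert e F))\<^sup>* then 0 else 1)"
    using num_components_insert[OF finite_verts b(7,3,4), of "edges G - insert e F"] by simp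
  ultimately show ?case using insert.IH[OF F] insert.hyps by simp
qed

lemma bond_rank_eq_dim:
  assumes "F \<subseteq> edges G"
  shows "bond_rank G F = int (fun_space.dim (res_vecs F))"
  using dim_res_vecs[OF assms] bond_rank_connected[OF num_components_edges, of F] by linarith

end

section \<open>Points and hyperplanes\<close>

text \<open>Over a finite field the product of all \<open>X - a\<close>, plus 1, is a nonconstant
  polynomial without a root.\<close>

lemma infinite_UNIV_alg_closed: "infinite (UNIV :: 'k::alg_closed_field set)"
proof
  assume fin: "finite (UNIV :: 'k set)"
  define p where "p = (\<Prod>a\<in>(UNIV :: 'k set). [:- a, 1:])"
  have "Polynomial.degree p = (\<Sum>a\<in>(UNIV :: 'k set). 1)"
    unfolding p_def by (subst degree_prod_eq_sum_degree) auto
  then have "Polynomial.degree p > 0" using fin by (simp add: card_gt_0_iff)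
  then have "Polynomial.degree (p + 1) > 0" by (subst degree_add_eq_left) simp_all
  then obtain a where "poly (p + 1) a = 0" using alg_closed_imp_poly_has_root by blast
  moreover have "poly p a = 0" unfolding p_def poly_prod using fin by (intro prod_zero) auto
  ultimately show False by simp
qed

lemma proj_point_smult:
  assumes "c \<noteq> 0"
  shows "proj_point (c \<cdot>\<^sub>v x) = proj_point x"
proof (intro subset_antisym subsetI)
  fix y assume "y \<in> proj_point (c \<cdot>\<^sub>v x)"
  then obtain d where "d \<noteq> 0" "y = d \<cdot>\<^sub>v (c \<cdot>\<^sub>v x)" by (auto simp: proj_point_def)
  then show "y \<in> proj_point x" using assms
    unfolding proj_point_def by (intro CollectI exI[of _ "d * c"]) (simp add: smult_smult_assoc)
next
  fix y assume "y \<in> proj_point x"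
  then obtain d where "d \<noteq> 0" "y = d \<cdot>\<^sub>v x" by (auto simp: proj_point_def)
  then show "y \<in> proj_point (c \<cdot>\<^sub>v x)" using assms
    unfolding proj_point_def by (intro CollectI exI[of _ "d / c"]) (simp add: smult_smult_assoc)
qed

lemma self_in_proj_point: "x \<in> proj_point x"
  unfolding proj_point_def by (intro CollectI exI[of _ 1]) simp

lemma vec_fun_scale: "vec n (fun_scale c f) = c \<cdot>\<^sub>v vec n f"
  by (intro eq_vecI) (simp_all add: fun_scale_def)

lemma scalar_prod_vec:
  assumes "h \<in> carrier_vec n"
  shows "h \<bullet> vec n f = pairing n h f"
  by (simp add: scalar_prod_def pairing_def lessThan_atLeast0)

lemma mem_hyperplane_iff:
  assumes h: "h \<in> carrier_vec n" and y: "y \<in> carrier_vec n" "y \<noteq> 0\<^sub>v n"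
  shows "proj_point y \<in> hyperplane n (proj_point h) \<longleftrightarrow> h \<bullet> y = 0"
proof
  assume "proj_point y \<in> hyperplane n (proj_point h)"
  then show "h \<bullet> y = 0" using self_in_proj_point by (auto simp: hyperplane_def)
next
  assume z: "h \<bullet> y = 0"
  have "h' \<bullet> y' = 0" if h': "h' \<in> proj_point h" and y': "y' \<in> proj_point y" for h' y'
  proof -
    obtain c where c: "h' = c \<cdot>\<^sub>v h" using h' by (auto simp: proj_point_def)
    obtain d where d: "y' = d \<cdot>\<^sub>v y" using y' by (auto simp: proj_point_def)
    have "h' \<bullet> y' = c * (d * (h \<bullet> y))" unfolding c d using h y by simp
    then show ?thesis using z by simp
  qed
  moreover have "proj_point y \<in> proj_space n" using y by (auto simp: proj_space_def)
  ultimately show "proj_point y \<in> hyperplane n (proj_point h)" by (simp add: hyperplane_def)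
qed

lemma pairing_add: "pairing n h (a + b) = pairing n h a + pairing n h b"
  by (simp add: pairing_def distrib_left sum.distrib)

lemma pairing_diff: "pairing n h (a - b) = pairing n h a - pairing n h b"
  by (simp add: pairing_def right_diff_distrib sum_subtractf)

lemma pairing_fun_scale: "pairing n h (fun_scale c a) = c * pairing n h a"
  unfolding pairing_def fun_scale_def sum_distrib_left by (simp only: mult.left_commute)

lemma linear_pairing: "Vector_Spaces.linear fun_scale (*) (pairing n h)"
  unfolding Vector_Spaces.linear_iff
  by (intro conjI allI pairing_add pairing_fun_scale)
    (rule fun_space.vector_space_axioms fun_functional.vs2.vector_space_axioms)+

lemma pairing_section_point: "pairing n h (section_point n h a b) = 0"
  by (simp add: section_point_def pairing_diff pairing_fun_scale)

section \<open>Independence of points in coordinates\<close>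

lemma independent_family_subset:
  assumes "independent_family fun_scale v A" "B \<subseteq> A" "finite A"
  shows "independent_family (fun_scale :: 'k::field \<Rightarrow> _) v B"
  unfolding independent_family_def
proof (intro allI impI)
  fix c :: "_ \<Rightarrow> 'k" assume c: "(\<Sum>i\<in>B. fun_scale (c i) (v i)) = 0"
  define d where "d = (\<lambda>i. if i \<in> B then c i else 0)"
  have "(\<Sum>i\<in>A. fun_scale (d i) (v i)) = (\<Sum>i\<in>B. fun_scale (c i) (v i))"
    using assms(2,3) by (intro sum.mono_neutral_cong_right) (auto simp: d_def)
  then have "\<forall>i\<in>A. d i = 0" using assms(1) c by (simp add: independent_family_def)
  then show "\<forall>i\<in>B. c i = 0" using assms(2) by (force simp: d_def)
qed

text \<open>Other representatives differ by nonzero factors \<open>d i\<close>, which the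
  coefficients absorb; because of the support condition it is enough to test coordinates below
  \<open>n\<close>.\<close>

lemma points_independent_iff:
  fixes v :: "'i \<Rightarrow> nat \<Rightarrow> 'k::field"
  assumes supp: "\<And>i j. i \<in> A \<Longrightarrow> n \<le> j \<Longrightarrow> v i j = 0"
  shows "points_independent n (\<lambda>i. proj_point (vec n (v i))) A \<longleftrightarrow> independent_family fun_scale v A"
proof
  assume "points_independent n (\<lambda>i. proj_point (vec n (v i))) A"
  then obtain w where w: "\<And>i. i \<in> A \<Longrightarrow> w i \<in> proj_point (vec n (v i))"
    and ind: "\<And>c. (\<forall>j<n. (\<Sum>i\<in>A. c i * vec_index (w i) j) = 0) \<Longrightarrow> (\<forall>i\<in>A. c i = 0)"
    unfolding points_independent_def by blast
  have "\<forall>i. \<exists>d. i \<in> A \<longrightarrow> d \<noteq> 0 \<and> w i = d \<cdot>\<^sub>v vec n (v i)"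
    using w unfolding proj_point_def by blast
  then obtain d where d: "\<And>i. i \<in> A \<Longrightarrow> d i \<noteq> 0 \<and> w i = d i \<cdot>\<^sub>v vec n (v i)" by metis
  show "independent_family fun_scale v A"
    unfolding independent_family_def
  proof (intro allI impI)
    fix c assume c: "(\<Sum>i\<in>A. fun_scale (c i) (v i)) = 0"
    have "(\<Sum>i\<in>A. c i / d i * vec_index (w i) j) = 0" if "j < n" for j
    proof -
      have "(\<Sum>i\<in>A. c i / d i * vec_index (w i) j) = (\<Sum>i\<in>A. fun_scale (c i) (v i) j)"
        using d that by (intro sum.cong) (auto simp: fun_scale_def)
      also have "\<dots> = (\<Sum>i\<in>A. fun_scale (c i) (v i)) j"
        by (induction A rule: infinite_finite_induct) auto
      finally show ?thesis using c by simp
    qed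
    then have "\<forall>i\<in>A. c i / d i = 0" using ind[of "\<lambda>i. c i / d i"] by blast
    then show "\<forall>i\<in>A. c i = 0" using d by simp
  qed
next
  assume ind: "independent_family fun_scale v A"
  show "points_independent n (\<lambda>i. proj_point (vec n (v i))) A"
    unfolding points_independent_def
  proof (intro exI[of _ "\<lambda>i. vec n (v i)"] conjI ballI allI impI)
    fix i show "vec n (v i) \<in> proj_point (vec n (v i))" by (rule self_in_proj_point)
  next
    fix c i assume c: "\<forall>j<n. (\<Sum>i\<in>A. c i * vec_index (vec n (v i)) j) = 0" and i: "i \<in> A"
    have "(\<Sum>i\<in>A. fun_scale (c i) (v i)) = 0"
    proof
      fix j
      have "(\<Sum>i\<in>A. fun_scale (c i) (v i)) j = (\<Sum>i\<in>A. fun_scale (c i) (v i) j)"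
        by (induction A rule: infinite_finite_induct) auto
      also have "\<dots> = 0"
      proof (cases "j < n")
        case True
        then show ?thesis using c by (simp add: fun_scale_def)
      next
        case False
        then show ?thesis using supp by (simp add: fun_scale_def)
      qed
      finally show "(\<Sum>i\<in>A. fun_scale (c i) (v i)) j = 0 j" by simp
    qed
    then show "c i = 0" using ind i by (simp add: independent_family_def)
  qed
qed

context canonical_graph_curve
begin

section \<open>The canonical lines\<close>

lemma line_vec_Aff: "line_vec v (Aff t) = av v + fun_scale t (bv v)"
  and line_vec_Infty: "line_vec v Infty = bv v"
  by (simp_all add: line_vec_def line_form_def fun_scale_def fun_eq_iff)

lemma line_vec_in_span: "line_vec v x \<in> fun_space.span {av v, bv v}"
proof (cases x)
  case (Aff t)
  then show ?thesis unfolding Aff line_vec_Aff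
    by (intro fun_space.span_add fun_space.span_scale fun_space.span_base) simp_all
next
  case Infty
  then show ?thesis unfolding Infty line_vec_Infty by (intro fun_space.span_base) simp
qed

text \<open>Two distinct points span a projective line. Infinity gives \<open>bv v\<close> outright;
  for two finite parameters it is a multiple of the difference of the points.\<close>

lemma av_bv_in_span:
  assumes xy: "x \<noteq> y" and X: "line_vec v x \<in> fun_space.span X" "line_vec v y \<in> fun_space.span X"
  shows "av v \<in> fun_space.span X \<and> bv v \<in> fun_space.span X"
proof -
  have b: "bv v \<in> fun_space.span X"
  proof (cases "x = Infty \<or> y = Infty")
    case True
    then show ?thesis using X by (auto simp: line_vec_Infty)
  next
    case False
    then obtain t t' where t: "x = Aff t" "y = Aff t'" by (metis proj_line.exhaust)
    have ne: "t - t' \<noteq> 0" using xy t by simp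
    have "line_vec v x - line_vec v y = fun_scale (t - t') (bv v)"
      unfolding t line_vec_Aff by (simp add: fun_space.scale_left_diff_distrib)
    then have "fun_scale (inverse (t - t')) (line_vec v x - line_vec v y) = bv v"
      using ne by simp
    then show ?thesis using X by (metis fun_space.span_diff fun_space.span_scale)
  qed
  have aff: "av v \<in> fun_space.span X" if "line_vec v (Aff t) \<in> fun_space.span X" for t
  proof -
    have "av v = line_vec v (Aff t) - fun_scale t (bv v)" by (simp add: line_vec_Aff)
    then show ?thesis using that b by (simp only: fun_space.span_diff fun_space.span_scale)
  qed
  show ?thesis
  proof (cases x)
    case (Aff t)
    then show ?thesis using aff X b by blast
  next
    case Infty
    then obtain t where "y = Aff t" using xy by (cases y) auto
    then show ?thesis using aff X b by blast
  qed
qed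

lemma incident_edges_subset: "incident_edges G A \<subseteq> edges G"
  by (auto simp: incident_edges_def)

text \<open>Both families of vectors have the same span. An edge with only one branch on
  \<open>B\<close> causes no loss, since its other residue vector is the negative of the first;
  conversely, two of the three nodes on a component already span its line.\<close>

lemma dim_lines:
  assumes B: "B \<subseteq> verts G"
  shows "int (fun_space.dim (av ` B \<union> bv ` B)) = bond_rank G (incident_edges G B)"
proof -
  let ?R = "res_vecs (incident_edges G B)"
  have "res_vec p \<in> fun_space.span (av ` B \<union> bv ` B)"
    if e: "e \<in> incident_edges G B" and p: "p \<in> br e" for e p
  proof -
    have in_B: "res_vec (v, x) \<in> fun_space.span (av ` B \<union> bv ` B)" if "v \<in> B" for v x
    proof -
      have "{av v, bv v} \<subseteq> av ` B \<union> bv ` B" using that by auto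
      then have "line_vec v x \<in> fun_space.span (av ` B \<union> bv ` B)"
        using line_vec_in_span fun_space.span_mono by blast
      then show ?thesis by (simp add: res_vec_def fun_space.span_scale)
    qed
    have eG: "e \<in> edges G" using e incident_edges_subset by blast
    obtain u x w y where b: "br e = {(u, x), (w, y)}" "u \<noteq> w" "ends G e = {#u, w#}"
      using branches_cases[OF eG] by metis
    have "res_vec (u, x) + res_vec (w, y) = 0"
      using sum_res_vec_branches[OF eG] b(1,2) by simp
    then have neg: "res_vec (u, x) = - res_vec (w, y)" "res_vec (w, y) = - res_vec (u, x)"
      by (simp_all add: eq_neg_iff_add_eq_0 add.commute)
    have "u \<in> B \<or> w \<in> B" using e b(3) by (auto simp: incident_edges_def)
    then have "res_vec (u, x) \<in> fun_space.span (av ` B \<union> bv ` B)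
        \<and> res_vec (w, y) \<in> fun_space.span (av ` B \<union> bv ` B)"
      using in_B fun_space.span_neg neg by metis
    then show ?thesis using p b(1) by auto
  qed
  then have 1: "?R \<subseteq> fun_space.span (av ` B \<union> bv ` B)" by (auto simp: res_vecs_def)
  have "av v \<in> fun_space.span ?R \<and> bv v \<in> fun_space.span ?R" if v: "v \<in> B" for v
  proof -
    have vG: "v \<in> verts G" using v B by blast
    obtain x y where xy: "x \<in> pts v" "y \<in> pts v" "x \<noteq> y"
      using card_pts[OF vG] by (auto simp: card_3_iff)
    have "line_vec v z \<in> fun_space.span ?R" if z: "z \<in> pts v" for z
    proof -
      obtain e where e: "e \<in> edges G" "(v, z) \<in> br e" using pts_branch[OF z] by blast
      have "v \<in># ends G e" using ends_branches[OF e(1)] e(2) by force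
      then have "e \<in> incident_edges G B" using e(1) v by (auto simp: incident_edges_def)
      then have "res_vec (v, z) \<in> fun_space.span ?R"
        using e(2) by (intro fun_space.span_base) (auto simp: res_vecs_def)
      then have "fun_scale (inverse (value_factor (pts v) z)) (res_vec (v, z)) \<in> fun_space.span ?R"
        by (rule fun_space.span_scale)
      then show ?thesis
        using value_factor_nonzero[OF finite_pts[OF vG], of z] by (simp add: res_vec_def)
    qed
    then show ?thesis using av_bv_in_span[OF xy(3)] xy by blast
  qed
  then have 2: "av ` B \<union> bv ` B \<subseteq> fun_space.span ?R" by auto
  have "fun_space.span (av ` B \<union> bv ` B) = fun_space.span ?R"
    using 1 2 by (meson fun_space.span_minimal fun_space.subspace_span subset_antisym)
  then show ?thesis
    unfolding bond_rank_eq_dim[OF incident_edges_subset] by (metis fun_space.span_eq_dim)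
qed

lemma card_incident_edges:
  assumes v: "v \<in> verts G"
  shows "card (incident_edges G {v}) = 3"
proof -
  have "degree G v = (\<Sum>e\<in>edges G. if e \<in> incident_edges G {v} then 1 else 0)"
    unfolding degree_def
  proof (rule sum.cong[OF refl])
    fix e assume e: "e \<in> edges G"
    obtain u x w y where "u \<noteq> w" "ends G e = {#u, w#}"
      using branches_cases[OF e] by metis
    then show "count (ends G e) v = (if e \<in> incident_edges G {v} then 1 else 0)"
      using e by (auto simp: incident_edges_def)
  qed
  also have "\<dots> = card (incident_edges G {v})"
    using finite_edges incident_edges_subset[of "{v}"]
    by (simp add: sum.If_cases Int_absorb1)
  finally show ?thesis using trivalent_G v by (simp add: trivalent_def)
qed

text \<open>Two edges at \<open>v\<close> whose joint removal leaves the graph connected have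
  residue vectors spanning dimension 2. Here 2-edge-connectedness is used beyond
  connectedness.\<close>

lemma dim_line:
  assumes v: "v \<in> verts G"
  shows "2 \<le> fun_space.dim {av v, bv v}"
proof -
  have loopless: "ends G e \<noteq> {#v, v#}" if "e \<in> edges G" for e
    using branches_cases[OF that] by (metis add_mset_eq_single add_eq_conv_ex)
  have "\<exists>e e'. e \<noteq> e' \<and> e \<in> incident_edges G {v} \<and> e' \<in> incident_edges G {v} \<and>
      num_components G (edges G - {e, e'}) = 1"
    by (rule exists_removable_pair[OF finite_G two_edge_connected_G v card_incident_edges[OF v]])
      (rule loopless)
  then obtain e e' where e: "e \<noteq> e'" "e \<in> incident_edges G {v}" "e' \<in> incident_edges G {v}"
    "num_components G (edges G - {e, e'}) = 1"
    by (elim exE conjE) (rule that; assumption)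
  have sub: "{e, e'} \<subseteq> edges G" using e(2,3) incident_edges_subset by blast
  have "fun_space.dim (res_vecs {e, e'}) = 2"
    using dim_res_vecs[OF sub] e(1,4) by simp
  moreover have "fun_space.dim (res_vecs {e, e'}) \<le> fun_space.dim (res_vecs (incident_edges G {v}))"
  proof (rule fun_space.dim_mono_finite)
    show "finite (res_vecs (incident_edges G {v}))"
      by (rule finite_res_vecs[OF incident_edges_subset])
    have "res_vecs {e, e'} \<subseteq> res_vecs (incident_edges G {v})" using e(2,3) by (auto simp: res_vecs_def)
    then show "res_vecs {e, e'} \<subseteq> fun_space.span (res_vecs (incident_edges G {v}))"
      using fun_space.span_superset by blast
  qed
  moreover have "int (fun_space.dim {av v, bv v}) = int (fun_space.dim (res_vecs (incident_edges G {v})))"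
    using dim_lines[of "{v}"] v bond_rank_eq_dim[OF incident_edges_subset, of "{v}"]
    by (simp add: insert_commute)
  ultimately show ?thesis by simp
qed

lemma line_independent:
  assumes v: "v \<in> verts G"
  shows "bv v \<noteq> 0" "av v \<notin> fun_space.span {bv v}"
proof -
  have d1: "fun_space.dim {bv v} \<le> 1"
    using fun_space.dim_le_card[OF fun_space.span_superset, of "{bv v}"] by simp
  show a: "av v \<notin> fun_space.span {bv v}"
    using dim_line[OF v] d1 fun_space.dim_insert_finite[of "{bv v}" "av v"] by (auto split: if_splits)
  show "bv v \<noteq> 0"
  proof
    assume "bv v = 0"
    then have "{bv v} \<subseteq> fun_space.span {}" by simp
    then have "fun_space.dim {bv v} \<le> card ({} :: (nat \<Rightarrow> 'k) set)" by (rule fun_space.dim_le_card) simp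
    then show False
      using dim_line[OF v] fun_space.dim_insert_finite[of "{bv v}" "av v"] by (auto split: if_splits)
  qed
qed

text \<open>Base point freeness of the dualizing sheaf along the component \<open>v\<close>.\<close>

lemma line_vec_nonzero:
  assumes v: "v \<in> verts G"
  shows "line_vec v x \<noteq> 0"
proof (cases x)
  case (Aff t)
  show ?thesis
  proof
    assume "line_vec v x = 0"
    then have "av v = fun_scale (- t) (bv v)"
      by (simp add: Aff line_vec_Aff eq_neg_iff_add_eq_0)
    then have "av v \<in> fun_space.span {bv v}"
      by (simp only: fun_space.span_scale fun_space.span_base singletonI)
    then show False using line_independent[OF v] by blast
  qed
qed (simp add: line_vec_Infty line_independent[OF v])

text \<open>The trivialization differs between nodes and other points, but this only rescales the
  coordinates, so one formula holds along the whole component.\<close>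

lemma canonical_map_eq:
  assumes v: "v \<in> verts G"
  shows "canonical_map C g s v x = proj_point (vec g (line_vec v x))"
proof -
  have "section_value C v x (s j) = value_factor (pts v) x * line_vec v x j" if "j < g" for j
    using has_leadD[OF has_lead_diff_expansion[OF card_pts[OF v], of x "av v j" "bv v j"]]
    by (simp add: section_value_def section_form[OF that v] line_vec_def)
  then have "vec g (\<lambda>j. section_value C v x (s j)) = value_factor (pts v) x \<cdot>\<^sub>v vec g (line_vec v x)"
    by (intro eq_vecI) simp_all
  then show ?thesis
    using proj_point_smult[OF value_factor_nonzero[OF finite_pts[OF v]]] by (simp add: canonical_map_def)
qed

section \<open>Intersection of a canonical line with a hyperplane\<close>

abbreviation sp :: "'k vec \<Rightarrow> 'v \<Rightarrow> nat \<Rightarrow> 'k" where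
  "sp h v \<equiv> section_point g h (av v) (bv v)"

text \<open>\<open>nz\<close> says that the line is not contained in the hyperplane; if it were, the
  section point would be the zero vector.\<close>

lemma line_vec_on_hyperplane:
  assumes nz: "pairing g h (av v) \<noteq> 0 \<or> pairing g h (bv v) \<noteq> 0"
  shows "pairing g h (line_vec v x) = 0 \<longleftrightarrow> (\<exists>c. c \<noteq> 0 \<and> sp h v = fun_scale c (line_vec v x))"
proof
  assume z: "pairing g h (line_vec v x) = 0"
  show "\<exists>c. c \<noteq> 0 \<and> sp h v = fun_scale c (line_vec v x)"
  proof (cases x)
    case (Aff t)
    have a: "pairing g h (av v) = - (t * pairing g h (bv v))"
      using z by (simp add: Aff line_vec_Aff pairing_add pairing_fun_scale eq_neg_iff_add_eq_0)
    then have "pairing g h (bv v) \<noteq> 0" using nz by auto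
    moreover have "sp h v = fun_scale (pairing g h (bv v)) (line_vec v x)"
      by (simp add: section_point_def a Aff line_vec_Aff fun_eq_iff fun_scale_def distrib_left)
    ultimately show ?thesis by blast
  next
    case Infty
    then have b: "pairing g h (bv v) = 0" using z by (simp add: line_vec_Infty)
    then have "sp h v = fun_scale (- pairing g h (av v)) (line_vec v x)"
      by (simp add: section_point_def Infty line_vec_Infty)
    then show ?thesis using nz b by (intro exI[of _ "- pairing g h (av v)"]) simp
  qed
next
  assume "\<exists>c. c \<noteq> 0 \<and> sp h v = fun_scale c (line_vec v x)"
  then show "pairing g h (line_vec v x) = 0"
    using pairing_section_point[of g h "av v" "bv v"] by (auto simp: pairing_fun_scale)
qed

lemma exists_line_vec_on_hyperplane:
  "\<exists>x. pairing g h (line_vec v x) = 0"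
proof (cases "pairing g h (bv v) = 0")
  case True
  then show ?thesis by (intro exI[of _ Infty]) (simp add: line_vec_Infty)
next
  case False
  then show ?thesis
    by (intro exI[of _ "Aff (- pairing g h (av v) / pairing g h (bv v))"])
      (simp add: line_vec_Aff pairing_add pairing_diff pairing_fun_scale)
qed

lemma canonical_line_inter_hyperplane:
  assumes v: "v \<in> verts G" and h: "h \<in> carrier_vec g"
    and nz: "pairing g h (av v) \<noteq> 0 \<or> pairing g h (bv v) \<noteq> 0"
  shows "canonical_line C g s v \<inter> hyperplane g (proj_point h) = {proj_point (vec g (sp h v))}"
proof -
  have vec_nz: "vec g (line_vec v x) \<noteq> 0\<^sub>v g" for x
  proof
    assume z: "vec g (line_vec v x) = 0\<^sub>v g"
    have "line_vec v x j = 0" for j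
      using arg_cong[OF z, of "\<lambda>u. vec_index u j"] line_vec_supported[of j v x]
      by (cases "j < g") simp_all
    then show False using line_vec_nonzero[OF v, of x] by (auto simp: fun_eq_iff)
  qed
  have on: "canonical_map C g s v x \<in> hyperplane g (proj_point h)
      \<longleftrightarrow> pairing g h (line_vec v x) = 0" for x
    unfolding canonical_map_eq[OF v]
    using mem_hyperplane_iff[OF h _ vec_nz] scalar_prod_vec[OF h] by simp
  have eq: "canonical_map C g s v x = proj_point (vec g (sp h v))"
    if z: "pairing g h (line_vec v x) = 0" for x
  proof -
    obtain c where "c \<noteq> 0" "sp h v = fun_scale c (line_vec v x)"
      using line_vec_on_hyperplane[OF nz] z by blast
    then show ?thesis by (simp add: canonical_map_eq[OF v] vec_fun_scale proj_point_smult)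
  qed
  show ?thesis
  proof (intro subset_antisym subsetI)
    fix p assume "p \<in> canonical_line C g s v \<inter> hyperplane g (proj_point h)"
    then obtain x where "p = canonical_map C g s v x" "p \<in> hyperplane g (proj_point h)"
      unfolding canonical_line_def by blast
    then show "p \<in> {proj_point (vec g (sp h v))}" using on eq by simp
  next
    fix p assume p: "p \<in> {proj_point (vec g (sp h v))}"
    obtain x where x: "pairing g h (line_vec v x) = 0" using exists_line_vec_on_hyperplane by blast
    have "p = canonical_map C g s v x" using eq[OF x] p by simp
    then show "p \<in> canonical_line C g s v \<inter> hyperplane g (proj_point h)"
      using on x by (simp add: canonical_line_def)
  qed
qed

end

section \<open>Comparison of the two matroids\<close>

text \<open>By finiteness every dependent set contains a minimal one, so containing a circuit
  amounts to containing any set that violates the strict rank inequality.\<close>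

lemma graph_curve_matroid_eq:
  assumes "finite (verts G)"
  shows "graph_curve_matroid G = (verts G, {A. A \<subseteq> verts G \<and>
    (\<forall>B\<subseteq>A. B \<noteq> {} \<longrightarrow> int (card B) < bond_rank G (incident_edges G B))})"
proof -
  have circ: "(\<exists>D\<in>gc_circuits G. D \<subseteq> A) \<longleftrightarrow> (\<exists>B\<subseteq>A. gc_dependent G B)" if A: "A \<subseteq> verts G" for A
  proof
    assume "\<exists>D\<in>gc_circuits G. D \<subseteq> A"
    then show "\<exists>B\<subseteq>A. gc_dependent G B" by (auto simp: gc_circuits_def)
  next
    assume "\<exists>B\<subseteq>A. gc_dependent G B"
    then obtain B where B: "B \<subseteq> A" "gc_dependent G B" by blast
    have "finite {B. B \<subseteq> A \<and> gc_dependent G B}"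
      using finite_subset[OF A assms] by simp
    from finite_has_minimal2[OF this, of B] B obtain D where D: "D \<subseteq> A" "gc_dependent G D"
      and min: "\<And>B. B \<subseteq> A \<Longrightarrow> gc_dependent G B \<Longrightarrow> B \<subseteq> D \<Longrightarrow> D = B" by auto
    have "D \<in> gc_circuits G" using D min by (auto simp: gc_circuits_def)
    then show "\<exists>D\<in>gc_circuits G. D \<subseteq> A" using D(1) by blast
  qed
  have dep: "gc_dependent G B \<longleftrightarrow> B \<noteq> {} \<and> \<not> int (card B) < bond_rank G (incident_edges G B)"
    if "B \<subseteq> verts G" for B
    using that by (simp add: gc_dependent_def not_less)
  have "A \<subseteq> verts G \<and> \<not> (\<exists>D\<in>gc_circuits G. D \<subseteq> A) \<longleftrightarrow>
      A \<subseteq> verts G \<and> (\<forall>B\<subseteq>A. B \<noteq> {} \<longrightarrow> int (card B) < bond_rank G (incident_edges G B))" for A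
  proof (rule conj_cong[OF refl])
    assume A: "A \<subseteq> verts G"
    have "(\<exists>B\<subseteq>A. gc_dependent G B)
        \<longleftrightarrow> (\<exists>B\<subseteq>A. B \<noteq> {} \<and> \<not> int (card B) < bond_rank G (incident_edges G B))"
      by (intro ex_cong1 conj_cong refl dep) (use A in blast)
    then show "(\<not> (\<exists>D\<in>gc_circuits G. D \<subseteq> A)) =
        (\<forall>B\<subseteq>A. B \<noteq> {} \<longrightarrow> int (card B) < bond_rank G (incident_edges G B))"
      unfolding circ[OF A] by blast
  qed
  then show ?thesis by (simp only: graph_curve_matroid_def matroid_of_circuits_def)
qed

context canonical_graph_curve
begin

lemma exists_independence_polynomial:
  assumes A: "A \<subseteq> verts G"
    and ind: "\<forall>B\<subseteq>A. B \<noteq> {} \<longrightarrow> int (card B) < bond_rank G (incident_edges G B)"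
  shows "\<exists>F\<in>homogeneous_poly_funs g. (\<exists>h\<in>carrier_vec g. F h \<noteq> 0) \<and>
    (\<forall>h\<in>carrier_vec g. F h \<noteq> 0 \<longrightarrow> independent_family fun_scale (sp h) A)"
proof (rule exists_generic_polynomial[OF infinite_UNIV_alg_closed finite_subset[OF A finite_verts]])
  show "av i j = 0 \<and> bv i j = 0" if "g \<le> j" for i j
    using av_bv_supported[OF that] .
  fix B assume B: "B \<subseteq> A" "B \<noteq> {}"
  then have "B \<subseteq> verts G" using A by blast
  from dim_lines[OF this] ind[rule_format, OF B]
  show "card B + 1 \<le> fun_space.dim (av ` B \<union> bv ` B)" by linarith
qed

text \<open>All section points lie on the hyperplane, while some generator \<open>z\<close> of a
  line does not, since no line is contained in it; \<open>z\<close> accounts for the extra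
  dimension.\<close>

lemma independent_sections_rank:
  assumes A: "A \<subseteq> verts G" and ind: "independent_family fun_scale (sp h) A"
    and nz: "\<And>v. v \<in> verts G \<Longrightarrow> pairing g h (av v) \<noteq> 0 \<or> pairing g h (bv v) \<noteq> 0"
    and B: "B \<subseteq> A" "B \<noteq> {}"
  shows "int (card B) < bond_rank G (incident_edges G B)"
proof -
  have BG: "B \<subseteq> verts G" using A B(1) by blast
  have finB: "finite B" by (rule finite_subset[OF BG finite_verts])
  have "independent_family fun_scale (sp h) B"
    using independent_family_subset[OF ind B(1) finite_subset[OF A finite_verts]] .
  then have dim: "fun_space.dim (sp h ` B) = card B"
    by (rule fun_space.dim_independent_family[OF finB])
  obtain v where v: "v \<in> B" using B(2) by blast
  obtain z where z: "z \<in> {av v, bv v}" "pairing g h z \<noteq> 0" using nz[of v] v BG by blast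
  have "z \<notin> fun_space.span (sp h ` B)"
  proof
    assume zs: "z \<in> fun_space.span (sp h ` B)"
    have "pairing g h f = 0" if "f \<in> sp h ` B" for f
      using that pairing_section_point by blast
    then have "pairing g h z = 0"
      using fun_functional.linear_eq_0_on_span[OF linear_pairing _ zs] by blast
    then show False using z(2) by blast
  qed
  then have "card B + 1 = fun_space.dim (insert z (sp h ` B))"
    using finB dim by (simp add: fun_space.dim_insert_finite)
  also have "\<dots> \<le> fun_space.dim (av ` B \<union> bv ` B)"
  proof (rule fun_space.dim_mono_finite)
    have "sp h i \<in> fun_space.span (av ` B \<union> bv ` B)" if "i \<in> B" for i
      unfolding section_point_def using that
      by (intro fun_space.span_diff fun_space.span_scale fun_space.span_base) auto
    moreover have "z \<in> fun_space.span (av ` B \<union> bv ` B)"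
      using z(1) v by (intro fun_space.span_base) auto
    ultimately show "insert z (sp h ` B) \<subseteq> fun_space.span (av ` B \<union> bv ` B)" by blast
  qed (use finB in simp)
  finally show ?thesis using dim_lines[OF BG] by linarith
qed

lemma section_matroid_eq:
  assumes h: "h \<in> carrier_vec g"
    and gen: "\<And>A. A \<subseteq> verts G \<Longrightarrow>
      (\<And>B. B \<subseteq> A \<Longrightarrow> B \<noteq> {} \<Longrightarrow> int (card B) < bond_rank G (incident_edges G B)) \<Longrightarrow>
      independent_family fun_scale (sp h) A"
    and nz: "\<And>v. v \<in> verts G \<Longrightarrow> pairing g h (av v) \<noteq> 0 \<or> pairing g h (bv v) \<noteq> 0"
  shows "graph_curve_matroid G = point_matroid g (verts G) (\<lambda>v. proj_point (vec g (sp h v)))"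
proof -
  have "sp h v j = 0" if "g \<le> j" for v j
    using av_bv_supported[OF that, of v] by (simp add: section_point_def fun_scale_def)
  then have "points_independent g (\<lambda>v. proj_point (vec g (sp h v))) A
      \<longleftrightarrow> independent_family fun_scale (sp h) A" for A
    by (intro points_independent_iff)
  moreover have "independent_family fun_scale (sp h) A
      \<longleftrightarrow> (\<forall>B\<subseteq>A. B \<noteq> {} \<longrightarrow> int (card B) < bond_rank G (incident_edges G B))"
    if "A \<subseteq> verts G" for A
    using gen[OF that] independent_sections_rank[OF that _ nz] by (intro iffI allI impI) simp_all
  ultimately show ?thesis
    unfolding graph_curve_matroid_eq[OF finite_verts] point_matroid_def by auto
qed

lemma singleton_rank:
  assumes v: "v \<in> verts G" and B: "B \<subseteq> {v}" "B \<noteq> {}"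
  shows "int (card B) < bond_rank G (incident_edges G B)"
proof -
  have "B = {v}" using B by blast
  then show ?thesis using dim_line[OF v] dim_lines[of "{v}"] v by (simp add: insert_commute)
qed

lemma generic_hyperplane_section:
  "generic_hyperplane g (\<lambda>H. \<exists>p. (\<forall>i\<in>verts G. canonical_line C g s i \<inter> H = {p i}) \<and>
     graph_curve_matroid G = point_matroid g (verts G) p)"
proof -
  \<comment> \<open>The independent sets of the graph curve matroid. Only these impose a condition,
    since all other sets have dependent section points on every hyperplane that contains no
    line.\<close>
  define I where "I = {A. A \<subseteq> verts G \<and>
    (\<forall>B\<subseteq>A. B \<noteq> {} \<longrightarrow> int (card B) < bond_rank G (incident_edges G B))}"
  have finI: "finite I" using finite_verts by (simp add: I_def)
  have "\<forall>A. \<exists>F. A \<in> I \<longrightarrow> F \<in> homogeneous_poly_funs g \<and> (\<exists>h\<in>carrier_vec g. F h \<noteq> 0) \<and>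
      (\<forall>h\<in>carrier_vec g. F h \<noteq> 0 \<longrightarrow> independent_family fun_scale (sp h) A)"
  proof (intro allI)
    fix A
    show "\<exists>F. A \<in> I \<longrightarrow> F \<in> homogeneous_poly_funs g \<and> (\<exists>h\<in>carrier_vec g. F h \<noteq> 0) \<and>
      (\<forall>h\<in>carrier_vec g. F h \<noteq> 0 \<longrightarrow> independent_family fun_scale (sp h) A)"
    proof (cases "A \<in> I")
      case True
      then have "A \<subseteq> verts G"
        "\<forall>B\<subseteq>A. B \<noteq> {} \<longrightarrow> int (card B) < bond_rank G (incident_edges G B)"
        by (simp_all add: I_def)
      from exists_independence_polynomial[OF this] show ?thesis by blast
    qed simp
  qed
  from choice[OF this] obtain F where "\<forall>A. A \<in> I \<longrightarrow> F A \<in> homogeneous_poly_funs g \<and>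
      (\<exists>h\<in>carrier_vec g. F A h \<noteq> 0) \<and>
      (\<forall>h\<in>carrier_vec g. F A h \<noteq> 0 \<longrightarrow> independent_family fun_scale (sp h) A)"
    by (elim exE)
  then have F: "\<And>A. A \<in> I \<Longrightarrow> F A \<in> homogeneous_poly_funs g"
    "\<And>A. A \<in> I \<Longrightarrow> \<exists>h\<in>carrier_vec g. F A h \<noteq> 0"
    "\<And>A h. A \<in> I \<Longrightarrow> h \<in> carrier_vec g \<Longrightarrow> F A h \<noteq> 0 \<Longrightarrow> independent_family fun_scale (sp h) A"
    by simp_all
  define P where "P = (\<lambda>h. \<Prod>A\<in>I. F A h)"
  have P: "P \<in> homogeneous_poly_funs g" "\<exists>h\<in>carrier_vec g. P h \<noteq> 0"
  proof -
    have "P \<in> homogeneous_poly_funs g \<and> (\<exists>h\<in>carrier_vec g. P h \<noteq> 0)"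
      unfolding P_def
      by (rule homogeneous_poly_funs_prod_nonvanishing[OF infinite_UNIV_alg_closed finI F(1,2)])
    then show "P \<in> homogeneous_poly_funs g" "\<exists>h\<in>carrier_vec g. P h \<noteq> 0" by simp_all
  qed
  have ind: "independent_family fun_scale (sp h) A"
    if "A \<in> I" "h \<in> carrier_vec g" "P h \<noteq> 0" for A h
  proof -
    have "F A h \<noteq> 0" using that(1,3) finI by (auto simp: P_def)
    then show ?thesis by (rule F(3)[OF that(1,2)])
  qed
  \<comment> \<open>Singletons belong to \<open>I\<close>, so nonvanishing of \<open>P\<close>
    already keeps every line out of the hyperplane.\<close>
  have nz: "pairing g h (av v) \<noteq> 0 \<or> pairing g h (bv v) \<noteq> 0"
    if v: "v \<in> verts G" and h: "h \<in> carrier_vec g" "P h \<noteq> 0" for v h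
  proof (rule ccontr)
    assume "\<not> ?thesis"
    then have "sp h v = 0" by (simp add: section_point_def)
    have "{v} \<in> I" using v singleton_rank[OF v] by (simp add: I_def)
    from ind[OF this h, unfolded independent_family_def, rule_format, of "\<lambda>_. 1" v]
    show False using \<open>sp h v = 0\<close> by simp
  qed
  define U where "U = {\<xi> \<in> proj_space g. \<exists>f\<in>{P}. \<exists>h\<in>\<xi>. f h \<noteq> 0}"
  have open_U: "zariski_open g U"
    unfolding zariski_open_def U_def using P(1) by (intro exI[of _ "{P}"]) simp
  have U_ne: "U \<noteq> {}"
  proof -
    obtain h where h: "h \<in> carrier_vec g" "P h \<noteq> 0" using P(2) by blast
    \<comment> \<open>A vertex is needed to see that \<open>h\<close> is nonzero and hence defines a
      hyperplane: both pairings at \<open>v\<close> would vanish for \<open>h = 0\<close>.\<close>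
    have "verts G \<noteq> {}"
      using num_components_edges by (auto simp: num_components_def quotient_def)
    then obtain v where v: "v \<in> verts G" by blast
    have "h \<noteq> 0\<^sub>v g"
      using nz[OF v h] by (auto simp: pairing_def)
    then have "proj_point h \<in> U"
      using h self_in_proj_point[of h] by (auto simp: U_def proj_space_def)
    then show ?thesis by blast
  qed
  have good: "\<exists>p. (\<forall>i\<in>verts G. canonical_line C g s i \<inter> hyperplane g \<xi> = {p i}) \<and>
      graph_curve_matroid G = point_matroid g (verts G) p" if \<xi>U: "\<xi> \<in> U" for \<xi>
  proof -
    obtain h0 h where h0: "h0 \<in> carrier_vec g" "\<xi> = proj_point h0" and h: "h \<in> \<xi>" "P h \<noteq> 0"
      using \<xi>U unfolding U_def proj_space_def by blast
    \<comment> \<open>\<open>P\<close> is known to be nonzero at one representative of the point,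
      and that representative becomes the coefficient vector.\<close>
    obtain c where c: "c \<noteq> 0" "h = c \<cdot>\<^sub>v h0" using h(1) h0(2) by (auto simp: proj_point_def)
    have hc: "h \<in> carrier_vec g" using c h0 by simp
    have \<xi>: "\<xi> = proj_point h" using proj_point_smult[OF c(1)] c(2) h0(2) by simp
    have "graph_curve_matroid G = point_matroid g (verts G) (\<lambda>v. proj_point (vec g (sp h v)))"
    proof (rule section_matroid_eq[OF hc])
      fix A assume "A \<subseteq> verts G"
        "\<And>B. B \<subseteq> A \<Longrightarrow> B \<noteq> {} \<Longrightarrow> int (card B) < bond_rank G (incident_edges G B)"
      then have "A \<in> I" unfolding I_def by blast
      then show "independent_family fun_scale (sp h) A" using hc h(2) by (rule ind)
    qed (rule nz[OF _ hc h(2)])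
    moreover have "\<forall>i\<in>verts G. canonical_line C g s i \<inter> hyperplane g \<xi> = {proj_point (vec g (sp h i))}"
      unfolding \<xi>
      by (intro ballI canonical_line_inter_hyperplane[OF _ hc] nz[OF _ hc h(2)])
    ultimately show ?thesis by (intro exI conjI)
  qed
  show ?thesis
    unfolding generic_hyperplane_def by (intro exI[of _ U] conjI ballI open_U U_ne good)
qed

end

theorem theorem2p8:
  fixes G :: "('v, 'e) multigraph"
    and C :: "('v, 'e, 'k::alg_closed_field) glued_curve"
    and g :: nat
    and s :: "nat \<Rightarrow> 'v \<Rightarrow> 'k poly fract"
  assumes "finite_multigraph G"
    and "trivalent G"
    and "two_edge_connected G"
    and "graph_curve C"
    and "has_dual_graph C G"
    and "canonical_basis C g s"
  shows "generic_hyperplane g (\<lambda>H. \<exists>p.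
           (\<forall>i\<in>verts G. canonical_line C g s i \<inter> H = {p i}) \<and>
           graph_curve_matroid G = point_matroid g (verts G) p)"
proof -
  interpret canonical_graph_curve G C g s
    using assms by unfold_locales
  show ?thesis by (rule generic_hyperplane_section)
qed

end
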